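(* Suppose that $p=p(n)$ and $\omega \log n \le d=pn \le n / \omega = o(n)$, where $\omega=\omega(n)$ is any function tending to infinity as $n \to \infty$ such that $\omega \le \log n$. Let $i=i(n) \in \mathbb{N}$ be the largest integer such that $d^i = o(n)$. Suppose that $d^{i+1} / n - 2 \log n \to \infty$. Then the following property holds asymptotically almost surely for $G = (V,E) \in \mathcal{G}(n,p)$: $$ \mathrm{eq}(G) \ge \mathrm{pq}(G) \ge k := \frac {n}{2 d^i} \log (d^i) \left(1 - \frac {1}{\omega^{1/3}} \right) = \Omega \left( \frac {n \log n}{d^i} \right). $$
   Context: Query game on a simple graph $G=(V,E)$: $d_G(u,v)$ denotes the graph distance. An adversary fixes a target vertex $v^*\in V$ unknown to an adaptive algorithm. In each round the algorithm queries two vertices $u,v$, and the adversary replies with whichever of $u,v$ is closer to $v^*$ (with either one, at the adversary's choice, if $d_G(u,v^* )=d_G(v,v^* )$). Equivalently: put $V_0=V$; in round $t$ the algorithm presents $(u_t,v_t)$ (depending on $G$ and earlier replies) and the adversary chooses either $V_t=\{x\in V_{t-1}: d_G(u_t,x)\le d_G(v_t,x)\}$ (reply $u_t$) or $V_t=\{x\in V_{t-1}: d_G(v_t,x)\le d_G(u_t,x)\}$ (reply $v_t$); the target is located once $|V_t|=1$. A pair query allows arbitrary $u,v\in V$; an edge query requires $u$ and $v$ to be adjacent. $\mathrm{pq}(G)$ (respectively $\mathrm{eq}(G)$) is the least integer $t$ such that the algorithm can locate the target in at most $t$ pair queries (respectively edge queries), regardless of the strategy of the adversary. $\mathcal{G}(n,p)$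 is the binomial random graph on vertex set $\{1,\dots,n\}$, each pair being an edge independently with probability $p=p(n)$. A property holds asymptotically almost surely (a.a.s.) if its probability tends to $1$ as $n\to\infty$. $\log$ is the natural logarithm, $\mathbb{N}=\{1,2,\dots\}$, and asymptotic notation is as $n\to\infty$. Expressions that have to be integers (such as $k$) are rounded up or down without specifying which. *)

theory Defs
  imports "HOL-Probability.Probability" "HOL-Library.Landau_Symbols"
begin

text \<open>A simple graph is a pair of a vertex set and a set of two-element subsets of it.\<close>

type_synonym 'a graph = "'a set \<times> 'a set set"

abbreviation verts :: "'a graph \<Rightarrow> 'a set" where
  "verts G \<equiv> fst G"

abbreviation edges :: "'a graph \<Rightarrow> 'a set set" where
  "edges G \<equiv> snd G"

definition adj_rel :: "'a graph \<Rightarrow> ('a \<times> 'a) set" where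
  "adj_rel G = {(u, v). {u, v} \<in> edges G}"

text \<open>Pairs in the \<open>k\<close>-th relational power of adjacency are those joined by a walk with
  \<open>k\<close> edges. The distance between different components is \<open>\<infinity>\<close>, the infimum of the empty set.\<close>

definition graph_dist :: "'a graph \<Rightarrow> 'a \<Rightarrow> 'a \<Rightarrow> enat" where
  "graph_dist G u v = Inf {enat k | k. (u, v) \<in> adj_rel G ^^ k}"


text \<open>The replies to the query \<open>(u, v)\<close> that are open to an adversary whose target is \<open>x\<close>;
  there are two of them exactly when \<open>u \<noteq> v\<close> are equidistant from \<open>x\<close>.\<close>

definition legal_replies :: "'a graph \<Rightarrow> 'a \<times> 'a \<Rightarrow> 'a \<Rightarrow> 'a set" where
  "legal_replies G q x = (case q of (u, v) \<Rightarrow>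
     {r \<in> {u, v}. graph_dist G r x \<le> graph_dist G u x \<and> graph_dist G r x \<le> graph_dist G v x})"

text \<open>An algorithm is a map from the list of earlier replies (oldest first) to the next query.
  The set \<open>candidates G \<sigma> rs\<close> is the set \<open>V\<^sub>t\<close> of possible targets after the
  \<open>t = length rs\<close> replies \<open>rs\<close>.\<close>

definition candidates :: "'a graph \<Rightarrow> ('a list \<Rightarrow> 'a \<times> 'a) \<Rightarrow> 'a list \<Rightarrow> 'a set" where
  "candidates G \<sigma> rs =
     {x \<in> verts G. \<forall>j<length rs. rs ! j \<in> legal_replies G (\<sigma> (take j rs)) x}"

text \<open>The condition \<open>x \<in> candidates G \<sigma> rs\<close> says that \<open>rs\<close> is a sequence of truthful replies
  for the target \<open>x\<close>. In particular the adversary cannot make the candidate set empty.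
  Requiring admissible queries also after the target has been located is harmless: any
  admissible query may be used as a filler.\<close>

definition locates_within ::
    "'a graph \<Rightarrow> ('a \<times> 'a) set \<Rightarrow> ('a list \<Rightarrow> 'a \<times> 'a) \<Rightarrow> nat \<Rightarrow> bool" where
  "locates_within G Q \<sigma> t \<longleftrightarrow>
     (\<forall>rs. length rs < t \<longrightarrow> \<sigma> rs \<in> Q) \<and>
     (\<forall>x\<in>verts G. \<forall>rs. length rs = t \<and> x \<in> candidates G \<sigma> rs \<longrightarrow>
        (\<exists>s\<le>t. card (candidates G \<sigma> (take s rs)) = 1))"

text \<open>The value is \<open>\<infinity>\<close> if no algorithm works, as for edge queries in a disconnected graph.\<close>

definition query_number :: "'a graph \<Rightarrow> ('a \<times> 'a) set \<Rightarrow> enat" where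
  "query_number G Q = Inf {enat t | t. \<exists>\<sigma>. locates_within G Q \<sigma> t}"

definition pq_number :: "'a graph \<Rightarrow> enat" where
  "pq_number G = query_number G (verts G \<times> verts G)"

definition eq_number :: "'a graph \<Rightarrow> enat" where
  "eq_number G = query_number G (adj_rel G)"


definition vertex_pairs :: "nat \<Rightarrow> nat set set" where
  "vertex_pairs n = {e. e \<subseteq> {1..n} \<and> card e = 2}"

definition binomial_random_graph :: "nat \<Rightarrow> real \<Rightarrow> nat graph pmf" where
  "binomial_random_graph n p =
     map_pmf (\<lambda>present. ({1..n}, {e \<in> vertex_pairs n. present e}))
       (Pi_pmf (vertex_pairs n) False (\<lambda>_. bernoulli_pmf p))"

definition asymptotically_almost_surely :: "(nat \<Rightarrow> 'a pmf) \<Rightarrow> (nat \<Rightarrow> 'a \<Rightarrow> bool) \<Rightarrow> bool" where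
  "asymptotically_almost_surely M P \<longleftrightarrow>
     (\<lambda>n. measure_pmf.prob (M n) {x. P n x}) \<longlonglongrightarrow> 1"


text \<open>``\<open>i = i(n)\<close> is the largest integer with \<open>d\<^sup>i = o(n)\<close>'', where \<open>i\<close> may vary with \<open>n\<close>.
  As the condition is asymptotic, a competing exponent function is only required to be at most
  \<open>i\<close> for all sufficiently large \<open>n\<close>.\<close>

definition largest_exponent :: "(nat \<Rightarrow> real) \<Rightarrow> (nat \<Rightarrow> nat) \<Rightarrow> bool" where
  "largest_exponent d i \<longleftrightarrow>
     (\<lambda>n. d n ^ i n) \<in> o(\<lambda>n. real n) \<and>
     (\<forall>j. (\<lambda>n. d n ^ j n) \<in> o(\<lambda>n. real n) \<longrightarrow> (\<forall>\<^sub>F n in sequentially. j n \<le> i n))"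

end

theory Submission
  imports Defs "HOL-Real_Asymp.Real_Asymp"
begin

text \<open>
  A vertex at distance exactly \<open>i + 1\<close> from all queried vertices is consistent with every reply.
  Fewer than \<open>k\<close> queries involve a set \<open>S\<close> of at most \<open>2k\<close> vertices, whose balls of radius \<open>i - 1\<close>
  contain about \<open>2k d\<^sup>i\<^sup>-\<^sup>1\<close> vertices in total; a further vertex has no edge to them with probability
  about \<open>exp (- 2k d\<^sup>i / n) = d\<^sup>-\<^sup>i exp (\<omega>\<^sup>-\<^sup>1\<^sup>/\<^sup>3 log d\<^sup>i)\<close>. By \<open>d\<^sup>i \<ge> \<surd>n\<close> the last factor exceeds every power
  of \<open>log n\<close>, so that a Chernoff bound survives the union over the \<open>n\<^sup>2\<^sup>k\<close> choices of the queries and at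
  least \<open>exp (\<omega>\<^sup>-\<^sup>1\<^sup>/\<^sup>3 log n / 4)\<close> vertices remain outside the balls of radius \<open>i\<close>.

  If \<open>d\<close> is below \<open>log\<^sup>2 n\<close>, fluctuations of the degrees may push the diameter above \<open>i + 1\<close>. It
  suffices, however, that few vertices are at distance more than \<open>i + 1\<close> from some vertex:
  all layers of all breadth-first explorations have their expected size up to a factor
  \<open>1 + O(\<omega>\<^sup>-\<^sup>1\<^sup>/\<^sup>2)\<close>, which yields at most \<open>exp (O(\<omega>\<^sup>-\<^sup>1\<^sup>/\<^sup>2) log n)\<close> such vertices, and this is of smaller
  order because \<open>\<omega>\<^sup>-\<^sup>1\<^sup>/\<^sup>2\<close> is small compared with \<open>\<omega>\<^sup>-\<^sup>1\<^sup>/\<^sup>3\<close>.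
\<close>

subsection \<open>Independence for products of Bernoulli variables\<close>

text \<open>Stands in for measurability with respect to the coordinates in \<open>A\<close>: for a
  finite product of Bernoulli variables, functions determined by disjoint coordinate sets are
  independent.\<close>

definition determined_by :: "'i set \<Rightarrow> (('i \<Rightarrow> 'b) \<Rightarrow> 'c) \<Rightarrow> bool" where
  "determined_by A g \<longleftrightarrow> (\<forall>x y. (\<forall>i\<in>A. x i = y i) \<longrightarrow> g x = g y)"

lemma determined_byD:
  assumes "determined_by A g" "\<And>i. i \<in> A \<Longrightarrow> x i = y i"
  shows "g x = g y"
  using assms by (auto simp: determined_by_def)

lemma determined_by_compose: "determined_by A g \<Longrightarrow> determined_by A (\<lambda>x. h (g x))"
  unfolding determined_by_def by metis

lemma determined_by_prod:
  assumes "\<And>x. x \<in> X \<Longrightarrow> determined_by (A x) (g x)"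
  shows "determined_by (\<Union>x\<in>X. A x) (\<lambda>f. \<Prod>x\<in>X. g x f)"
  unfolding determined_by_def
proof (intro allI impI)
  fix f h :: "'b \<Rightarrow> 'c"
  assume "\<forall>i\<in>\<Union>x\<in>X. A x. f i = h i"
  then have "g x f = g x h" if "x \<in> X" for x
    using that by (intro determined_byD[OF assms]) auto
  then show "(\<Prod>x\<in>X. g x f) = (\<Prod>x\<in>X. g x h)"
    by (rule prod.cong[OF refl])
qed

lemma expectation_pair_mult:
  fixes g :: "'a \<Rightarrow> real" and h :: "'b \<Rightarrow> real"
  assumes "finite (set_pmf M)" "finite (set_pmf N)"
  shows "measure_pmf.expectation (pair_pmf M N) (\<lambda>z. g (fst z) * h (snd z)) =
         measure_pmf.expectation M g * measure_pmf.expectation N h"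
proof -
  have "measure_pmf.expectation (pair_pmf M N) (\<lambda>z. g (fst z) * h (snd z))
      = (\<Sum>z\<in>set_pmf M \<times> set_pmf N. g (fst z) * h (snd z) * pmf (pair_pmf M N) z)"
    using assms by (intro integral_measure_pmf_real) auto
  also have "\<dots> = (\<Sum>x\<in>set_pmf M. \<Sum>y\<in>set_pmf N. (g x * pmf M x) * (h y * pmf N y))"
    unfolding sum.cartesian_product
    by (intro sum.cong) (auto simp: pmf_pair)
  also have "\<dots> = (\<Sum>x\<in>set_pmf M. g x * pmf M x) * (\<Sum>y\<in>set_pmf N. h y * pmf N y)"
    by (simp add: sum_product)
  also have "\<dots> = measure_pmf.expectation M g * measure_pmf.expectation N h"
    using assms by (simp add: integral_measure_pmf_real)
  finally show ?thesis .
qed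

lemma finite_set_Pi_pmf_bool:
  fixes P :: "'i \<Rightarrow> bool pmf"
  assumes "finite I"
  shows "finite (set_pmf (Pi_pmf I dflt P))"
  using assms by (simp add: set_Pi_pmf finite_PiE_dflt)

text \<open>The product over \<open>I\<close> is glued from independent products over
  \<open>I \<inter> A\<close> and \<open>I - A\<close>. On a glued pair, \<open>g\<close> sees only
  the first component and \<open>h\<close> only the second.\<close>

lemma expectation_Pi_pmf_mult_indep:
  fixes P :: "'i \<Rightarrow> bool pmf" and g h :: "('i \<Rightarrow> bool) \<Rightarrow> real"
  assumes "finite I" "determined_by A g" "determined_by B h" "A \<inter> B = {}"
  shows "measure_pmf.expectation (Pi_pmf I dflt P) (\<lambda>x. g x * h x) =
         measure_pmf.expectation (Pi_pmf I dflt P) g * measure_pmf.expectation (Pi_pmf I dflt P) h"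
proof -
  let ?M = "Pi_pmf (I \<inter> A) dflt P" and ?N = "Pi_pmf (I - A) dflt P"
  let ?glue = "\<lambda>(f, g) x. if x \<in> I \<inter> A then f x else g x"
  have fin: "finite (set_pmf ?M)" "finite (set_pmf ?N)"
    using assms(1) by (auto intro!: finite_set_Pi_pmf_bool)
  have I: "Pi_pmf I dflt P = map_pmf ?glue (pair_pmf ?M ?N)"
    using Pi_pmf_union[of "I \<inter> A" "I - A" dflt P] assms(1) by (simp add: Int_Diff_Un Int_Diff_disjoint)
  have outside: "fst z i = dflt" if "z \<in> set_pmf (pair_pmf ?M ?N)" "i \<notin> I \<inter> A" for z i
    using that assms(1) set_Pi_pmf_subset[of "I \<inter> A" dflt P] by auto
  have outside': "snd z i = dflt" if "z \<in> set_pmf (pair_pmf ?M ?N)" "i \<notin> I - A" for z i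
    using that assms(1) set_Pi_pmf_subset[of "I - A" dflt P] by auto
  \<comment> \<open>At a coordinate of \<open>A\<close> outside \<open>I\<close> the gluing map
    reads the second component. Both components equal \<open>dflt\<close> there, so \<open>g\<close>
    notices no difference.\<close>
  have g: "g (?glue z) = g (fst z)" if "z \<in> set_pmf (pair_pmf ?M ?N)" for z
    by (rule determined_byD[OF assms(2)])
       (use outside[OF that] outside'[OF that] in \<open>auto simp: case_prod_beta\<close>)
  have h: "h (?glue z) = h (snd z)" if "z \<in> set_pmf (pair_pmf ?M ?N)" for z
    by (rule determined_byD[OF assms(3)]) (use assms(4) in \<open>auto simp: case_prod_beta\<close>)
  have Eg: "measure_pmf.expectation (Pi_pmf I dflt P) g = measure_pmf.expectation ?M g"
  proof -
    have "measure_pmf.expectation (Pi_pmf I dflt P) g =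
        measure_pmf.expectation (pair_pmf ?M ?N) (\<lambda>z. g (fst z))"
      unfolding I integral_map_pmf by (intro integral_cong_AE AE_pmfI g) auto
    then show ?thesis by simp
  qed
  have Eh: "measure_pmf.expectation (Pi_pmf I dflt P) h = measure_pmf.expectation ?N h"
  proof -
    have "measure_pmf.expectation (Pi_pmf I dflt P) h =
        measure_pmf.expectation (pair_pmf ?M ?N) (\<lambda>z. h (snd z))"
      unfolding I integral_map_pmf by (intro integral_cong_AE AE_pmfI h) auto
    then show ?thesis by simp
  qed
  have "measure_pmf.expectation (Pi_pmf I dflt P) (\<lambda>x. g x * h x) =
      measure_pmf.expectation (pair_pmf ?M ?N) (\<lambda>z. g (fst z) * h (snd z))"
    unfolding I integral_map_pmf
    by (intro integral_cong_AE AE_pmfI) (simp_all only: g h measurable_measure_pmf, auto)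
  also have "\<dots> = measure_pmf.expectation ?M g * measure_pmf.expectation ?N h"
    by (rule expectation_pair_mult[OF fin])
  finally show ?thesis by (simp add: Eg Eh)
qed

lemma expectation_Pi_pmf_prod_indep:
  fixes P :: "'i \<Rightarrow> bool pmf" and g :: "'x \<Rightarrow> ('i \<Rightarrow> bool) \<Rightarrow> real"
  assumes "finite I" "finite X" "\<And>x. x \<in> X \<Longrightarrow> determined_by (A x) (g x)"
    and "disjoint_family_on A X"
  shows "measure_pmf.expectation (Pi_pmf I dflt P) (\<lambda>f. \<Prod>x\<in>X. g x f) =
         (\<Prod>x\<in>X. measure_pmf.expectation (Pi_pmf I dflt P) (g x))"
  using assms(2,3,4)
proof (induction X rule: finite_induct)
  case (insert x X)
  have dis: "A x \<inter> (\<Union>y\<in>X. A y) = {}"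
  proof -
    have "A x \<inter> A y = {}" if "y \<in> X" for y
      using disjoint_family_onD[OF insert.prems(2), of x y] that insert.hyps(2) by fastforce
    then show ?thesis by auto
  qed
  have det: "determined_by (\<Union>y\<in>X. A y) (\<lambda>f. \<Prod>y\<in>X. g y f)"
    by (intro determined_by_prod insert.prems(1) insertI2)
  have IH: "measure_pmf.expectation (Pi_pmf I dflt P) (\<lambda>f. \<Prod>y\<in>X. g y f) =
         (\<Prod>y\<in>X. measure_pmf.expectation (Pi_pmf I dflt P) (g y))"
    using disjoint_family_on_mono[OF subset_insertI insert.prems(2)]
    by (intro insert.IH insert.prems(1) insertI2)
  have "measure_pmf.expectation (Pi_pmf I dflt P) (\<lambda>f. g x f * (\<Prod>y\<in>X. g y f)) =
      measure_pmf.expectation (Pi_pmf I dflt P) (g x) *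
      measure_pmf.expectation (Pi_pmf I dflt P) (\<lambda>f. \<Prod>y\<in>X. g y f)"
    by (rule expectation_Pi_pmf_mult_indep[OF assms(1) insert.prems(1)[OF insertI1] det dis])
  then show ?case
    using insert.hyps by (simp add: IH)
qed auto

lemma prob_Pi_pmf_conj_indep:
  fixes P :: "'i \<Rightarrow> bool pmf"
  assumes "finite I" "determined_by A Q" "determined_by B R" "A \<inter> B = {}"
  shows "measure_pmf.prob (Pi_pmf I dflt P) {f. Q f \<and> R f} =
         measure_pmf.prob (Pi_pmf I dflt P) {f. Q f} * measure_pmf.prob (Pi_pmf I dflt P) {f. R f}"
proof -
  have "measure_pmf.expectation (Pi_pmf I dflt P) (\<lambda>f. of_bool (Q f) * of_bool (R f) :: real) =
      measure_pmf.expectation (Pi_pmf I dflt P) (\<lambda>f. of_bool (Q f)) *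
      measure_pmf.expectation (Pi_pmf I dflt P) (\<lambda>f. of_bool (R f))"
    by (rule expectation_Pi_pmf_mult_indep[OF assms(1)
          determined_by_compose[OF assms(2)] determined_by_compose[OF assms(3)] assms(4)])
  moreover have "(\<lambda>f. of_bool (Q f) * of_bool (R f) :: real) = indicator {f. Q f \<and> R f}"
    by (rule ext) (simp add: indicator_def)
  moreover have "(\<lambda>f. of_bool (Q f) :: real) = indicator {f. Q f}"
    by (rule ext) (simp add: indicator_def)
  moreover have "(\<lambda>f. of_bool (R f) :: real) = indicator {f. R f}"
    by (rule ext) (simp add: indicator_def)
  ultimately show ?thesis by simp
qed

subsection \<open>Chernoff bounds\<close>

lemma card_filter_eq_sum: "finite X \<Longrightarrow> real (card {x \<in> X. E x}) = (\<Sum>x\<in>X. of_bool (E x))"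
  by (simp add: sum.If_cases of_bool_def Int_def)

text \<open>The exponential of a count is a product of one factor per \<open>x\<close>, and these
  factors depend on disjoint sets of coordinates.\<close>

lemma expectation_exp_card:
  fixes P :: "'i \<Rightarrow> bool pmf" and E :: "'x \<Rightarrow> ('i \<Rightarrow> bool) \<Rightarrow> bool"
  assumes "finite I" "finite X" "\<And>x. x \<in> X \<Longrightarrow> determined_by (A x) (E x)"
    and "disjoint_family_on A X"
  shows "measure_pmf.expectation (Pi_pmf I dflt P) (\<lambda>f. exp (s * real (card {x \<in> X. E x f}))) =
         (\<Prod>x\<in>X. 1 + (exp s - 1) * measure_pmf.prob (Pi_pmf I dflt P) {f. E x f})"
proof -
  let ?M = "Pi_pmf I dflt P"
  have "measure_pmf.expectation ?M (\<lambda>f. exp (s * real (card {x \<in> X. E x f}))) =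
      measure_pmf.expectation ?M (\<lambda>f. \<Prod>x\<in>X. exp (s * of_bool (E x f)))"
    by (simp only: card_filter_eq_sum[OF assms(2)] sum_distrib_left exp_sum[OF assms(2)])
  also have "\<dots> = (\<Prod>x\<in>X. measure_pmf.expectation ?M (\<lambda>f. exp (s * of_bool (E x f))))"
    by (rule expectation_Pi_pmf_prod_indep[OF assms(1,2) _ assms(4)])
       (rule determined_by_compose[OF assms(3), where h="\<lambda>b. exp (s * of_bool b)"])
  also have "\<dots> = (\<Prod>x\<in>X. 1 + (exp s - 1) * measure_pmf.prob ?M {f. E x f})"
  proof (rule prod.cong[OF refl])
    fix x
    have "(\<lambda>f. exp (s * of_bool (E x f))) = (\<lambda>f. 1 + (exp s - 1) * indicator {f. E x f} f)"
      by (auto simp: indicator_def fun_eq_iff)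
    then show "measure_pmf.expectation ?M (\<lambda>f. exp (s * of_bool (E x f))) =
        1 + (exp s - 1) * measure_pmf.prob ?M {f. E x f}"
      by (simp add: integrable_measure_pmf_finite[OF finite_set_Pi_pmf_bool[OF assms(1)]])
  qed
  finally show ?thesis .
qed

lemma markov_pmf:
  fixes g :: "'a \<Rightarrow> real"
  assumes "finite (set_pmf M)" "\<And>x. 0 \<le> g x" "0 < c"
  shows "measure_pmf.prob M {x. c \<le> g x} \<le> measure_pmf.expectation M g / c"
  using integral_Markov_inequality_measure[of M g "{}" c] assms
  by (simp add: integrable_measure_pmf_finite)

lemma exp_minus_le_quadratic:
  fixes s :: real
  assumes "0 \<le> s"
  shows "exp (-s) \<le> 1 - s + s\<^sup>2"
proof -
  have "1 + s \<le> exp s" by simp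
  then have "exp (-s) \<le> 1 / (1 + s)"
    using assms by (simp add: exp_minus field_simps)
  also have "\<dots> \<le> 1 - s + s\<^sup>2"
    using assms by (simp add: field_simps power2_eq_square)
  finally show ?thesis .
qed

text \<open>Markov's inequality for the exponential moment. The mean enters only through an upper
  bound \<open>\<mu>\<close>, because adjacency probabilities are only estimated later on.\<close>

lemma chernoff_upper:
  fixes P :: "'i \<Rightarrow> bool pmf" and E :: "'x \<Rightarrow> ('i \<Rightarrow> bool) \<Rightarrow> bool"
  assumes "finite I" "finite X" "\<And>x. x \<in> X \<Longrightarrow> determined_by (A x) (E x)"
    and "disjoint_family_on A X"
    and prob: "\<And>x. x \<in> X \<Longrightarrow> measure_pmf.prob (Pi_pmf I dflt P) {f. E x f} \<le> q"
    and \<mu>: "real (card X) * q \<le> \<mu>" and \<delta>: "0 \<le> \<delta>" "\<delta> \<le> 1"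
  shows "measure_pmf.prob (Pi_pmf I dflt P) {f. (1 + \<delta>) * \<mu> \<le> real (card {x \<in> X. E x f})}
           \<le> exp (- \<delta>\<^sup>2 * \<mu> / 4)"
\<comment> \<open>For empty \<open>X\<close> the sign of \<open>q\<close> is unconstrained, and
  \<open>0 \<le> \<mu>\<close> has to come from the hypothesis on \<open>\<mu>\<close>
  itself.\<close>
proof (cases "X = {}")
  case True
  then show ?thesis
  proof (cases "\<mu> = 0")
    case False
    then have "\<mu> > 0" using \<mu> True by simp
    then have "{f. (1 + \<delta>) * \<mu> \<le> real (card {x \<in> X. E x f})} = {}"
      using True \<delta> by (auto simp: not_le mult_pos_pos)
    then show ?thesis by simp
  qed (use True in auto)
next
  case False
  \<comment> \<open>This value minimises the exponent
    \<open>(s\<^sup>2 - s * \<delta>) * \<mu>\<close> that remains after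
    \<open>exp s - 1 \<le> s + s\<^sup>2\<close>.\<close>
  define s where "s = \<delta> / 2"
  have s: "0 \<le> s" "s \<le> 1" using \<delta> by (auto simp: s_def)
  let ?M = "Pi_pmf I dflt P"
  have q: "0 \<le> q" using prob False measure_nonneg order_trans by (metis ex_in_conv)
  have \<mu>0: "0 \<le> \<mu>" using \<mu> q by (meson mult_nonneg_nonneg of_nat_0_le_iff order_trans)
  have "{f. (1 + \<delta>) * \<mu> \<le> real (card {x \<in> X. E x f})} \<subseteq>
      {f. exp (s * ((1 + \<delta>) * \<mu>)) \<le> exp (s * real (card {x \<in> X. E x f}))}"
    using s by (auto intro!: mult_left_mono)
  then have "measure_pmf.prob ?M {f. (1 + \<delta>) * \<mu> \<le> real (card {x \<in> X. E x f})} \<le>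
      measure_pmf.prob ?M {f. exp (s * ((1 + \<delta>) * \<mu>)) \<le> exp (s * real (card {x \<in> X. E x f}))}"
    by (intro measure_pmf.finite_measure_mono) auto
  also have "\<dots> \<le> measure_pmf.expectation ?M (\<lambda>f. exp (s * real (card {x \<in> X. E x f}))) /
      exp (s * ((1 + \<delta>) * \<mu>))"
    by (intro markov_pmf finite_set_Pi_pmf_bool assms(1)) auto
  also have "measure_pmf.expectation ?M (\<lambda>f. exp (s * real (card {x \<in> X. E x f}))) =
      (\<Prod>x\<in>X. 1 + (exp s - 1) * measure_pmf.prob ?M {f. E x f})"
    by (rule expectation_exp_card[OF assms(1-4)])
  also have "\<dots> \<le> (\<Prod>x\<in>X. exp ((exp s - 1) * q))"
  proof (intro prod_mono conjI)
    fix x assume "x \<in> X"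
    show "0 \<le> 1 + (exp s - 1) * measure_pmf.prob ?M {f. E x f}"
      using s by (intro add_nonneg_nonneg mult_nonneg_nonneg) auto
    have "1 + (exp s - 1) * measure_pmf.prob ?M {f. E x f} \<le> 1 + (exp s - 1) * q"
      using s prob[OF \<open>x \<in> X\<close>] by (intro add_mono mult_left_mono) auto
    also have "\<dots> \<le> exp ((exp s - 1) * q)" by simp
    finally show "1 + (exp s - 1) * measure_pmf.prob ?M {f. E x f} \<le> exp ((exp s - 1) * q)" .
  qed
  also have "\<dots> = exp ((exp s - 1) * (real (card X) * q))"
    by (simp add: exp_of_nat_mult[symmetric] mult_ac)
  also have "\<dots> \<le> exp ((s + s\<^sup>2) * \<mu>)"
    unfolding exp_le_cancel_iff
    using s exp_bound[of s] q \<mu> by (intro mult_mono) auto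
  finally have "measure_pmf.prob ?M {f. (1 + \<delta>) * \<mu> \<le> real (card {x \<in> X. E x f})} \<le>
      exp ((s + s\<^sup>2) * \<mu>) / exp (s * ((1 + \<delta>) * \<mu>))"
    by (simp add: divide_right_mono)
  also have "\<dots> = exp (- \<delta>\<^sup>2 * \<mu> / 4)"
    by (simp add: exp_diff[symmetric] s_def power2_eq_square field_simps)
  finally show ?thesis .
qed

text \<open>The same argument with \<open>-s\<close> in place of \<open>s\<close>, where
  \<open>exp (-s) \<le> 1 - s + s\<^sup>2\<close> leads to the same exponent.\<close>

lemma chernoff_lower:
  fixes P :: "'i \<Rightarrow> bool pmf" and E :: "'x \<Rightarrow> ('i \<Rightarrow> bool) \<Rightarrow> bool"
  assumes "finite I" "finite X" "\<And>x. x \<in> X \<Longrightarrow> determined_by (A x) (E x)"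
    and "disjoint_family_on A X"
    and prob: "\<And>x. x \<in> X \<Longrightarrow> q \<le> measure_pmf.prob (Pi_pmf I dflt P) {f. E x f}"
    and \<mu>: "\<mu> \<le> real (card X) * q" "0 \<le> \<mu>" and \<delta>: "0 \<le> \<delta>" "\<delta> \<le> 1"
  shows "measure_pmf.prob (Pi_pmf I dflt P) {f. real (card {x \<in> X. E x f}) \<le> (1 - \<delta>) * \<mu>}
           \<le> exp (- \<delta>\<^sup>2 * \<mu> / 4)"
proof -
  define s where "s = \<delta> / 2"
  have s: "0 \<le> s" "s \<le> 1" using \<delta> by (auto simp: s_def)
  let ?M = "Pi_pmf I dflt P"
  have "{f. real (card {x \<in> X. E x f}) \<le> (1 - \<delta>) * \<mu>} \<subseteq>
      {f. exp (-s * ((1 - \<delta>) * \<mu>)) \<le> exp (-s * real (card {x \<in> X. E x f}))}"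
    unfolding exp_le_cancel_iff
    using s by (intro Collect_mono impI mult_left_mono_neg) simp_all
  then have "measure_pmf.prob ?M {f. real (card {x \<in> X. E x f}) \<le> (1 - \<delta>) * \<mu>} \<le>
      measure_pmf.prob ?M {f. exp (-s * ((1 - \<delta>) * \<mu>)) \<le> exp (-s * real (card {x \<in> X. E x f}))}"
    by (intro measure_pmf.finite_measure_mono) auto
  also have "\<dots> \<le> measure_pmf.expectation ?M (\<lambda>f. exp (-s * real (card {x \<in> X. E x f}))) /
      exp (-s * ((1 - \<delta>) * \<mu>))"
    by (intro markov_pmf finite_set_Pi_pmf_bool assms(1)) auto
  also have "measure_pmf.expectation ?M (\<lambda>f. exp (-s * real (card {x \<in> X. E x f}))) =
      (\<Prod>x\<in>X. 1 + (exp (-s) - 1) * measure_pmf.prob ?M {f. E x f})"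
    by (rule expectation_exp_card[OF assms(1-4)])
  also have "\<dots> \<le> (\<Prod>x\<in>X. exp ((exp (-s) - 1) * q))"
  proof (intro prod_mono conjI)
    fix x assume "x \<in> X"
    have "(1 - exp (-s)) * measure_pmf.prob ?M {f. E x f} \<le> 1 * 1"
      using s by (intro mult_mono) auto
    then show "0 \<le> 1 + (exp (-s) - 1) * measure_pmf.prob ?M {f. E x f}"
      by (simp add: algebra_simps)
    have "1 + (exp (-s) - 1) * measure_pmf.prob ?M {f. E x f} \<le> 1 + (exp (-s) - 1) * q"
      using s prob[OF \<open>x \<in> X\<close>] by (intro add_left_mono mult_left_mono_neg) auto
    also have "\<dots> \<le> exp ((exp (-s) - 1) * q)" by simp
    finally show "1 + (exp (-s) - 1) * measure_pmf.prob ?M {f. E x f} \<le> exp ((exp (-s) - 1) * q)" .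
  qed
  also have "\<dots> = exp ((exp (-s) - 1) * (real (card X) * q))"
    by (simp add: exp_of_nat_mult[symmetric] mult_ac)
  also have "\<dots> \<le> exp ((exp (-s) - 1) * \<mu>)"
    unfolding exp_le_cancel_iff using s \<mu> by (intro mult_left_mono_neg) auto
  also have "\<dots> \<le> exp ((- s + s\<^sup>2) * \<mu>)"
    unfolding exp_le_cancel_iff
    using s exp_minus_le_quadratic[of s] \<mu> by (intro mult_right_mono) auto
  finally have "measure_pmf.prob ?M {f. real (card {x \<in> X. E x f}) \<le> (1 - \<delta>) * \<mu>} \<le>
      exp ((- s + s\<^sup>2) * \<mu>) / exp (-s * ((1 - \<delta>) * \<mu>))"
    by (simp add: divide_right_mono)
  also have "\<dots> = exp (- \<delta>\<^sup>2 * \<mu> / 4)"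
    by (simp add: exp_diff[symmetric] s_def power2_eq_square field_simps)
  finally show ?thesis .
qed

subsection \<open>Breadth-first exploration\<close>

text \<open>After \<open>j\<close> rounds, the pair consists of the vertices at distance less than \<open>j\<close> from \<open>S\<close>
  and of those at distance exactly \<open>j\<close>.\<close>

fun expl :: "nat \<Rightarrow> nat set \<Rightarrow> (nat set \<Rightarrow> bool) \<Rightarrow> nat \<Rightarrow> nat set \<times> nat set" where
  "expl n S f 0 = ({}, S)"
| "expl n S f (Suc j) = (case expl n S f j of (B, L) \<Rightarrow>
     (B \<union> L, {x \<in> {1..n} - (B \<union> L). \<exists>y\<in>L. f {x, y}}))"

definition layer :: "nat \<Rightarrow> nat set \<Rightarrow> (nat set \<Rightarrow> bool) \<Rightarrow> nat \<Rightarrow> nat set" where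
  "layer n S f j = snd (expl n S f j)"

definition explored :: "nat \<Rightarrow> nat set \<Rightarrow> (nat set \<Rightarrow> bool) \<Rightarrow> nat \<Rightarrow> nat set" where
  "explored n S f j = fst (expl n S f j)"

lemma layer_0 [simp]: "layer n S f 0 = S"
  by (simp add: layer_def)

lemma explored_0 [simp]: "explored n S f 0 = {}"
  by (simp add: explored_def)

lemma explored_Suc: "explored n S f (Suc j) = explored n S f j \<union> layer n S f j"
  by (simp add: explored_def layer_def split: prod.split)

lemma layer_Suc:
  "layer n S f (Suc j) =
     {x \<in> {1..n} - (explored n S f j \<union> layer n S f j). \<exists>y\<in>layer n S f j. f {x, y}}"
  by (simp add: explored_def layer_def split: prod.split)

lemma expl_eq: "expl n S f j = (explored n S f j, layer n S f j)"
  by (simp add: explored_def layer_def)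

lemma explored_eq_UN: "explored n S f j = (\<Union>l<j. layer n S f l)"
  by (induction j) (auto simp: explored_Suc lessThan_Suc)

lemma layer_subset: "S \<subseteq> {1..n} \<Longrightarrow> layer n S f j \<subseteq> {1..n}"
  by (cases j) (auto simp: layer_Suc)

lemma explored_subset: "S \<subseteq> {1..n} \<Longrightarrow> explored n S f j \<subseteq> {1..n}"
  unfolding explored_eq_UN by (intro UN_least layer_subset)

lemma explored_layer_disjoint: "explored n S f j \<inter> layer n S f j = {}"
  by (cases j) (auto simp: layer_Suc explored_Suc)

text \<open>Every edge inspected in the first \<open>j\<close> rounds has an end point in a layer
  that has been merged into \<open>B\<close> by the end; edges at the last layer \<open>L\<close>
  that avoid \<open>B\<close> are still undisclosed.\<close>

lemma expl_determined:
  assumes "\<And>e. e \<inter> B \<noteq> {} \<Longrightarrow> f e = g e" "expl n S f j = (B, L)"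
  shows "expl n S g j = (B, L)"
  using assms
proof (induction j arbitrary: B L)
  case (Suc j)
  obtain B' L' where E: "expl n S f j = (B', L')" by fastforce
  have B: "B = B' \<union> L'" and L: "L = {x \<in> {1..n} - (B' \<union> L'). \<exists>y\<in>L'. f {x, y}}"
    using Suc.prems(2) E by auto
  have "expl n S g j = (B', L')"
    using Suc.prems(1) by (intro Suc.IH[OF _ E]) (auto simp: B)
  moreover have "f {x, y} = g {x, y}" if "y \<in> L'" for x y
    using that by (intro Suc.prems(1)) (auto simp: B)
  ultimately show ?case
    by (auto simp: B L)
qed auto

lemma determined_by_expl:
  "determined_by {e. e \<inter> B \<noteq> {}} (\<lambda>f. expl n S f j = (B, L))"
  unfolding determined_by_def
proof (intro allI impI)
  fix f g :: "nat set \<Rightarrow> bool"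
  assume *: "\<forall>e\<in>{e. e \<inter> B \<noteq> {}}. f e = g e"
  show "(expl n S f j = (B, L)) = (expl n S g j = (B, L))"
    using expl_determined[of B f g] expl_determined[of B g f] * by blast
qed

abbreviation edge_pmf :: "nat \<Rightarrow> real \<Rightarrow> (nat set \<Rightarrow> bool) pmf" where
  "edge_pmf n p \<equiv> Pi_pmf (vertex_pairs n) False (\<lambda>_. bernoulli_pmf p)"

lemma finite_vertex_pairs [simp]: "finite (vertex_pairs n)"
  unfolding vertex_pairs_def by (rule finite_subset[of _ "Pow {1..n}"]) auto

text \<open>Deferred decisions: an event about the edges avoiding the explored vertices is independent
  of the outcome of the exploration so far.\<close>

lemma prob_expl_le:
  assumes S: "S \<subseteq> {1..n}" and c: "0 \<le> c"
    and det: "\<And>B L. B \<inter> L = {} \<Longrightarrow> determined_by {e. e \<inter> B = {}} (R B L)"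
    and R: "\<And>B L. B \<subseteq> {1..n} \<Longrightarrow> L \<subseteq> {1..n} \<Longrightarrow> B \<inter> L = {} \<Longrightarrow> Q B L \<Longrightarrow>
              measure_pmf.prob (edge_pmf n p) {f. R B L f} \<le> c"
  shows "measure_pmf.prob (edge_pmf n p)
           {f. Q (explored n S f j) (layer n S f j) \<and> R (explored n S f j) (layer n S f j) f} \<le> c"
proof -
  let ?M = "edge_pmf n p"
  \<comment> \<open>The possible outcomes of the exploration on which \<open>Q\<close> holds. Given
    one of them, \<open>R\<close> concerns only edges avoiding \<open>B\<close> and is independent
    of having reached it.\<close>
  define Z where "Z = {(B, L). B \<subseteq> {1..n} \<and> L \<subseteq> {1..n} \<and> B \<inter> L = {} \<and> Q B L}"
  have finZ: "finite Z"
    by (rule finite_subset[of _ "Pow {1..n} \<times> Pow {1..n}"]) (auto simp: Z_def)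
  define F where "F = (\<lambda>(B, L). {f. expl n S f j = (B, L) \<and> R B L f})"
  define H where "H = (\<lambda>(B, L). {f. expl n S f j = (B, L)})"
  have "{f. Q (explored n S f j) (layer n S f j) \<and> R (explored n S f j) (layer n S f j) f} \<subseteq> (\<Union>z\<in>Z. F z)"
    using explored_subset[OF S] layer_subset[OF S] explored_layer_disjoint
    by (auto simp: Z_def F_def expl_eq)
  then have "measure_pmf.prob ?M
        {f. Q (explored n S f j) (layer n S f j) \<and> R (explored n S f j) (layer n S f j) f}
      \<le> measure_pmf.prob ?M (\<Union>z\<in>Z. F z)"
    by (intro measure_pmf.finite_measure_mono) auto
  also have "\<dots> \<le> (\<Sum>z\<in>Z. measure_pmf.prob ?M (F z))"
    by (rule measure_pmf.finite_measure_subadditive_finite[OF finZ]) auto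
  also have "\<dots> \<le> (\<Sum>z\<in>Z. measure_pmf.prob ?M (H z) * c)"
  proof (rule sum_mono)
    fix z assume z: "z \<in> Z"
    obtain B L where BL: "z = (B, L)" by fastforce
    have "measure_pmf.prob ?M (F z) =
        measure_pmf.prob ?M (H z) * measure_pmf.prob ?M {f. R B L f}"
      unfolding BL F_def H_def prod.case
      by (rule prob_Pi_pmf_conj_indep[OF finite_vertex_pairs determined_by_expl det])
         (use z in \<open>auto simp: Z_def BL\<close>)
    also have "\<dots> \<le> measure_pmf.prob ?M (H z) * c"
      using R z by (intro mult_left_mono) (auto simp: BL Z_def)
    finally show "measure_pmf.prob ?M (F z) \<le> measure_pmf.prob ?M (H z) * c" .
  qed
  \<comment> \<open>Distinct outcomes are disjoint events, so averaging over them loses nothing: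
    their probabilities add up to at most 1.\<close>
  also have "\<dots> = measure_pmf.prob ?M (\<Union>z\<in>Z. H z) * c"
    unfolding sum_distrib_right[symmetric]
    by (subst measure_pmf.finite_measure_finite_Union[OF finZ])
       (auto simp: disjoint_family_on_def H_def)
  also have "\<dots> \<le> 1 * c"
    using c by (intro mult_right_mono) auto
  finally show ?thesis by simp
qed

text \<open>The edge sets \<open>{{x, y} |y. y \<in> L}\<close> for \<open>x\<close> outside of \<open>L\<close> are disjoint, so that
  the events of being adjacent to \<open>L\<close> are independent.\<close>

lemma determined_by_adjacent:
  "determined_by ((\<lambda>y. {x, y}) ` L) (\<lambda>f. \<exists>y\<in>L. f {x, y})"
  unfolding determined_by_def by (intro allI impI bex_cong) simp_all

lemma disjoint_adjacent: "X \<inter> L = {} \<Longrightarrow> disjoint_family_on (\<lambda>x. (\<lambda>y. {x, y}) ` L) X"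
  by (auto simp: disjoint_family_on_def doubleton_eq_iff)

lemma prob_not_adjacent:
  assumes "L \<subseteq> {1..n}" "x \<in> {1..n} - L" "0 \<le> p" "p \<le> 1"
  shows "measure_pmf.prob (edge_pmf n p) {f. \<not> (\<exists>y\<in>L. f {x, y})} = (1 - p) ^ card L"
proof -
  have fin: "finite L" using assms(1) finite_subset by blast
  let ?A = "(\<lambda>y. {x, y}) ` L" and ?B = "\<lambda>e. if e \<in> (\<lambda>y. {x, y}) ` L then {False} else UNIV"
  \<comment> \<open>Since \<open>x\<close> is not in \<open>L\<close>, there are no loops among
    these sets, and each of the \<open>card L\<close> pairs is a genuine coordinate of the
    product.\<close>
  have sub: "?A \<subseteq> vertex_pairs n"
    using assms by (auto simp: vertex_pairs_def card_insert_if)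
  have inj: "inj_on (\<lambda>y. {x, y}) L"
    by (auto simp: inj_on_def doubleton_eq_iff)
  have "{f. \<not> (\<exists>y\<in>L. f {x, y})} = Pi (vertex_pairs n) ?B"
  proof (rule set_eqI)
    fix f
    have "f \<in> Pi (vertex_pairs n) ?B \<longleftrightarrow> (\<forall>e\<in>?A. \<not> f e)"
      using sub by (auto simp only: Pi_iff split: if_splits)
    then show "f \<in> {f. \<not> (\<exists>y\<in>L. f {x, y})} \<longleftrightarrow> f \<in> Pi (vertex_pairs n) ?B"
      by simp
  qed
  then have "measure_pmf.prob (edge_pmf n p) {f. \<not> (\<exists>y\<in>L. f {x, y})} =
      (\<Prod>e\<in>vertex_pairs n. measure_pmf.prob (bernoulli_pmf p) (?B e))"
    by (simp only: measure_Pi_pmf_Pi[OF finite_vertex_pairs])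
  also have "\<dots> = (\<Prod>e\<in>?A. measure_pmf.prob (bernoulli_pmf p) (?B e))"
    using sub by (intro prod.mono_neutral_right) auto
  also have "\<dots> = (\<Prod>e\<in>?A. 1 - p)"
    using assms(3,4) by (intro prod.cong) (auto simp: measure_pmf_single)
  also have "\<dots> = (1 - p) ^ card L"
    by (simp add: card_image[OF inj])
  finally show ?thesis .
qed

lemma prob_adjacent:
  assumes "L \<subseteq> {1..n}" "x \<in> {1..n} - L" "0 \<le> p" "p \<le> 1"
  shows "measure_pmf.prob (edge_pmf n p) {f. \<exists>y\<in>L. f {x, y}} = 1 - (1 - p) ^ card L"
  using measure_pmf.prob_compl[of "{f. \<exists>y\<in>L. f {x, y}}" "edge_pmf n p"] prob_not_adjacent[OF assms]
  by (simp add: Compl_eq_Diff_UNIV[symmetric] Collect_neg_eq[symmetric])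

section \<open>One round of the exploration: growth of the next layer and vertices that it
  misses\<close>

definition fresh :: "nat \<Rightarrow> nat set \<Rightarrow> nat set \<Rightarrow> nat set" where
  "fresh n B L = {1..n} - (B \<union> L)"

lemma layer_Suc_fresh:
  "layer n S f (Suc j) =
     {x \<in> fresh n (explored n S f j) (layer n S f j). \<exists>y\<in>layer n S f j. f {x, y}}"
  by (simp add: layer_Suc fresh_def)

text \<open>A fresh vertex and a vertex of \<open>L\<close> both lie outside \<open>B\<close>, so
  the edge between them avoids \<open>B\<close>. This is the counterpart of
  \<open>determined_by_expl\<close>.\<close>

lemma determined_by_next_layer:
  assumes "B \<inter> L = {}"
  shows "determined_by {e. e \<inter> B = {}} (\<lambda>f. {x \<in> fresh n B L. \<exists>y\<in>L. f {x, y}})"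
  unfolding determined_by_def
proof (intro allI impI Collect_cong conj_cong refl bex_cong)
  fix f g :: "nat set \<Rightarrow> bool" and x y
  assume "\<forall>e\<in>{e. e \<inter> B = {}}. f e = g e" "x \<in> fresh n B L" "y \<in> L"
  moreover from this have "{x, y} \<inter> B = {}" using assms by (auto simp: fresh_def)
  ultimately show "f {x, y} = g {x, y}" by blast
qed

lemma fresh_props: "finite (fresh n B L)" "card (fresh n B L) \<le> n" "fresh n B L \<inter> L = {}"
  using card_mono[of "{1..n}" "fresh n B L"] by (auto simp: fresh_def)

lemma card_fresh_ge:
  assumes "B \<subseteq> {1..n}" "L \<subseteq> {1..n}" "real (card (B \<union> L)) \<le> K"
  shows "real n - K \<le> real (card (fresh n B L))"
proof -
  have "card (fresh n B L) = n - card (B \<union> L)"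
    unfolding fresh_def using assms by (subst card_Diff_subset) (auto intro: finite_subset)
  then show ?thesis using assms(3) by linarith
qed

lemma one_minus_power_ge: "0 \<le> p \<Longrightarrow> p \<le> 1 \<Longrightarrow> 1 - real c * p \<le> (1 - p) ^ c" for p :: real
  using Bernoulli_inequality[of "-p" c] by simp

lemma one_minus_power_le_exp:
  fixes p m :: real
  assumes "0 \<le> p" "p \<le> 1" "m \<le> real c"
  shows "(1 - p) ^ c \<le> exp (- (p * m))"
proof -
  have "(1 - p) ^ c \<le> exp (- p) ^ c"
    using assms exp_ge_add_one_self[of "-p"] by (intro power_mono) auto
  also have "\<dots> = exp (- (p * real c))"
    by (simp add: exp_of_nat_mult[symmetric] mult.commute)
  also have "\<dots> \<le> exp (- (p * m))"
    using assms by (simp add: mult_left_mono)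
  finally show ?thesis .
qed

text \<open>Given the exploration so far, a fresh vertex has a neighbour in the layer with
  probability at most \<open>p * m\<close> by Bernoulli's inequality, independently of the other
  fresh vertices.\<close>

lemma prob_next_layer_large:
  assumes S: "S \<subseteq> {1..n}" and p: "0 \<le> p" "p \<le> 1" and \<delta>: "0 \<le> \<delta>" "\<delta> \<le> 1"
  shows "measure_pmf.prob (edge_pmf n p)
           {f. real (card (layer n S f j)) \<le> m \<and>
               (1 + \<delta>) * (real n * p * m) \<le> real (card (layer n S f (Suc j)))}
         \<le> exp (- \<delta>\<^sup>2 * (real n * p * m) / 4)"
  unfolding layer_Suc_fresh
proof (rule prob_expl_le[OF S, where Q="\<lambda>B L. real (card L) \<le> m" and
      R="\<lambda>B L f. (1 + \<delta>) * (real n * p * m) \<le> real (card {x \<in> fresh n B L. \<exists>y\<in>L. f {x, y}})"])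
  fix B L :: "nat set" assume "B \<inter> L = {}"
  then show "determined_by {e. e \<inter> B = {}} (\<lambda>f. (1 + \<delta>) * (real n * p * m) \<le>
      real (card {x \<in> fresh n B L. \<exists>y\<in>L. f {x, y}}))"
    by (rule determined_by_compose[OF determined_by_next_layer])
next
  fix B L assume BL: "B \<subseteq> {1..n}" "L \<subseteq> {1..n}" "B \<inter> L = {}" and m: "real (card L) \<le> m"
  show "measure_pmf.prob (edge_pmf n p)
      {f. (1 + \<delta>) * (real n * p * m) \<le> real (card {x \<in> fresh n B L. \<exists>y\<in>L. f {x, y}})}
    \<le> exp (- \<delta>\<^sup>2 * (real n * p * m) / 4)"
  proof (rule chernoff_upper[OF finite_vertex_pairs fresh_props(1) determined_by_adjacent
        disjoint_adjacent[OF fresh_props(3)] _ _ \<delta>])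
    fix x assume "x \<in> fresh n B L"
    then have "measure_pmf.prob (edge_pmf n p) {f. \<exists>y\<in>L. f {x, y}} = 1 - (1 - p) ^ card L"
      using BL p by (intro prob_adjacent) (auto simp: fresh_def)
    also have "\<dots> \<le> real (card L) * p"
      using one_minus_power_ge[OF p, of "card L"] by simp
    also have "\<dots> \<le> p * m"
      using m p by (simp add: mult.commute[of p] mult_right_mono)
    finally show "measure_pmf.prob (edge_pmf n p) {f. \<exists>y\<in>L. f {x, y}} \<le> p * m" .
  next
    have "0 \<le> m" using m by linarith
    then have "real (card (fresh n B L)) * (p * m) \<le> real n * (p * m)"
      using fresh_props(2)[of n B L] p by (intro mult_right_mono) auto
    then show "real (card (fresh n B L)) * (p * m) \<le> real n * p * m"
      by (simp add: mult.assoc)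
  qed
qed auto

text \<open>At least \<open>n - K\<close> vertices are fresh, and each misses a layer of size at
  least \<open>m\<close> with probability at most \<open>exp (- (p * m))\<close>.\<close>

lemma prob_next_layer_small:
  assumes S: "S \<subseteq> {1..n}" and p: "0 \<le> p" "p \<le> 1" and \<delta>: "0 \<le> \<delta>" "\<delta> \<le> 1"
    and m: "0 \<le> m" and K: "K \<le> real n"
  defines "\<mu> \<equiv> (real n - K) * (1 - exp (- (p * m)))"
  shows "measure_pmf.prob (edge_pmf n p)
           {f. (real (card (explored n S f j \<union> layer n S f j)) \<le> K \<and> m \<le> real (card (layer n S f j))) \<and>
               real (card (layer n S f (Suc j))) \<le> (1 - \<delta>) * \<mu>}
         \<le> exp (- \<delta>\<^sup>2 * \<mu> / 4)"
  unfolding layer_Suc_fresh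
proof (rule prob_expl_le[OF S,
      where Q="\<lambda>B L. real (card (B \<union> L)) \<le> K \<and> m \<le> real (card L)" and
      R="\<lambda>B L f. real (card {x \<in> fresh n B L. \<exists>y\<in>L. f {x, y}}) \<le> (1 - \<delta>) * \<mu>"])
  fix B L :: "nat set" assume "B \<inter> L = {}"
  then show "determined_by {e. e \<inter> B = {}} (\<lambda>f.
      real (card {x \<in> fresh n B L. \<exists>y\<in>L. f {x, y}}) \<le> (1 - \<delta>) * \<mu>)"
    by (rule determined_by_compose[OF determined_by_next_layer])
next
  fix B L assume BL: "B \<subseteq> {1..n}" "L \<subseteq> {1..n}" "B \<inter> L = {}"
    and Q: "real (card (B \<union> L)) \<le> K \<and> m \<le> real (card L)"
  show "measure_pmf.prob (edge_pmf n p)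
      {f. real (card {x \<in> fresh n B L. \<exists>y\<in>L. f {x, y}}) \<le> (1 - \<delta>) * \<mu>}
    \<le> exp (- \<delta>\<^sup>2 * \<mu> / 4)"
  proof (rule chernoff_lower[OF finite_vertex_pairs fresh_props(1) determined_by_adjacent
        disjoint_adjacent[OF fresh_props(3)] _ _ _ \<delta>])
    fix x assume "x \<in> fresh n B L"
    then have "measure_pmf.prob (edge_pmf n p) {f. \<exists>y\<in>L. f {x, y}} = 1 - (1 - p) ^ card L"
      using BL p by (intro prob_adjacent) (auto simp: fresh_def)
    then show "1 - exp (- (p * m)) \<le> measure_pmf.prob (edge_pmf n p) {f. \<exists>y\<in>L. f {x, y}}"
      using one_minus_power_le_exp[OF p, of m "card L"] Q by simp
  next
    show "\<mu> \<le> real (card (fresh n B L)) * (1 - exp (- (p * m)))"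
      unfolding \<mu>_def using card_fresh_ge[OF BL(1,2)] Q p m by (intro mult_right_mono) auto
    show "0 \<le> \<mu>"
      unfolding \<mu>_def using K p m by (intro mult_nonneg_nonneg) auto
  qed
qed auto

text \<open>After \<open>j + 2\<close> rounds the explored set is the ball of radius
  \<open>j + 1\<close>. A vertex outside of it is fresh after \<open>j\<close> rounds and has none
  of its at least \<open>m\<close> potential edges to layer \<open>j\<close>.\<close>

lemma prob_not_reached:
  assumes S: "S \<subseteq> {1..n}" and p: "0 \<le> p" "p \<le> 1" and x: "x \<in> {1..n}"
  shows "measure_pmf.prob (edge_pmf n p)
           {f. m \<le> real (card (layer n S f j)) \<and> x \<notin> explored n S f (Suc (Suc j))}
         \<le> exp (- (p * m))"
proof -
  have "x \<notin> explored n S f (Suc (Suc j)) \<longleftrightarrow>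
      x \<in> fresh n (explored n S f j) (layer n S f j) \<and>
      x \<notin> {x \<in> fresh n (explored n S f j) (layer n S f j). \<exists>y\<in>layer n S f j. f {x, y}}" for f
    using x by (auto simp: explored_Suc[of _ _ _ "Suc j"] explored_Suc[of _ _ _ j] layer_Suc_fresh fresh_def)
  then have eq: "{f. m \<le> real (card (layer n S f j)) \<and> x \<notin> explored n S f (Suc (Suc j))} =
      {f. m \<le> real (card (layer n S f j)) \<and>
      (x \<in> fresh n (explored n S f j) (layer n S f j) \<and>
      x \<notin> {x \<in> fresh n (explored n S f j) (layer n S f j). \<exists>y\<in>layer n S f j. f {x, y}})}"
    by blast
  show ?thesis
    unfolding eq
  proof (rule prob_expl_le[OF S, where Q="\<lambda>B L. m \<le> real (card L)" and
      R="\<lambda>B L f. x \<in> fresh n B L \<and> x \<notin> {x \<in> fresh n B L. \<exists>y\<in>L. f {x, y}}"])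
    fix B L :: "nat set" assume "B \<inter> L = {}"
    then show "determined_by {e. e \<inter> B = {}}
        (\<lambda>f. x \<in> fresh n B L \<and> x \<notin> {x \<in> fresh n B L. \<exists>y\<in>L. f {x, y}})"
      by (rule determined_by_compose[OF determined_by_next_layer])
  next
    fix B L assume BL: "B \<subseteq> {1..n}" "L \<subseteq> {1..n}" "B \<inter> L = {}" and m: "m \<le> real (card L)"
    show "measure_pmf.prob (edge_pmf n p)
        {f. x \<in> fresh n B L \<and> x \<notin> {x \<in> fresh n B L. \<exists>y\<in>L. f {x, y}}} \<le> exp (- (p * m))"
    proof (cases "x \<in> fresh n B L")
      case True
      then have "measure_pmf.prob (edge_pmf n p) {f. \<not> (\<exists>y\<in>L. f {x, y})} = (1 - p) ^ card L"
        using BL p by (intro prob_not_adjacent) (auto simp: fresh_def)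
      then show ?thesis
        using True one_minus_power_le_exp[OF p m] by simp
    qed simp
  qed auto
qed

text \<open>The last layer has at most \<open>t\<close> vertices, so a fresh vertex stays uncovered
  with probability at least \<open>(1 - p) powr t\<close>. Chernoff with deviation
  \<open>1 / 2\<close> gives a bound small enough for a union over all choices of queried
  vertices.\<close>

lemma prob_few_uncovered:
  assumes S: "S \<subseteq> {1..n}" and p: "0 \<le> p" "p < 1" and t: "t \<le> real n"
  defines "\<mu> \<equiv> (real n - t) * (1 - p) powr t"
  shows "measure_pmf.prob (edge_pmf n p)
           {f. real (card (explored n S f j \<union> layer n S f j)) \<le> t \<and>
               real (card ({1..n} - explored n S f (Suc (Suc j)))) \<le> \<mu> / 2}
         \<le> exp (- \<mu> / 16)"
proof -
  have "{1..n} - explored n S f (Suc (Suc j)) =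
      fresh n (explored n S f j) (layer n S f j) -
      {x \<in> fresh n (explored n S f j) (layer n S f j). \<exists>y\<in>layer n S f j. f {x, y}}" for f
    by (auto simp: explored_Suc[of _ _ _ "Suc j"] explored_Suc[of _ _ _ j] layer_Suc_fresh fresh_def)
  then have eq: "{f. real (card (explored n S f j \<union> layer n S f j)) \<le> t \<and>
               real (card ({1..n} - explored n S f (Suc (Suc j)))) \<le> \<mu> / 2} =
      {f. real (card (explored n S f j \<union> layer n S f j)) \<le> t \<and>
      real (card (fresh n (explored n S f j) (layer n S f j) -
      {x \<in> fresh n (explored n S f j) (layer n S f j). \<exists>y\<in>layer n S f j. f {x, y}})) \<le> \<mu> / 2}"
    by simp
  show ?thesis
    unfolding eq
  proof (rule prob_expl_le[OF S, where Q="\<lambda>B L. real (card (B \<union> L)) \<le> t" and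
      R="\<lambda>B L f. real (card (fresh n B L - {x \<in> fresh n B L. \<exists>y\<in>L. f {x, y}})) \<le> \<mu> / 2"])
    fix B L :: "nat set" assume "B \<inter> L = {}"
    then show "determined_by {e. e \<inter> B = {}}
        (\<lambda>f. real (card (fresh n B L - {x \<in> fresh n B L. \<exists>y\<in>L. f {x, y}})) \<le> \<mu> / 2)"
      by (rule determined_by_compose[OF determined_by_next_layer])
  next
    fix B L assume BL: "B \<subseteq> {1..n}" "L \<subseteq> {1..n}" "B \<inter> L = {}" and Q: "real (card (B \<union> L)) \<le> t"
    have "card L \<le> card (B \<union> L)"
      using BL by (intro card_mono) (auto intro: finite_subset)
    then have L: "real (card L) \<le> t" using Q by linarith
    have diff: "fresh n B L - {x \<in> fresh n B L. \<exists>y\<in>L. f {x, y}} =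
        {x \<in> fresh n B L. \<not> (\<exists>y\<in>L. f {x, y})}" for f
      by blast
    have half: "\<mu> / 2 = (1 - 1 / 2) * \<mu>" and "exp (- \<mu> / 16) = exp (- (1/2)\<^sup>2 * \<mu> / 4)"
      by (auto simp: power2_eq_square)
    show "measure_pmf.prob (edge_pmf n p)
        {f. real (card (fresh n B L - {x \<in> fresh n B L. \<exists>y\<in>L. f {x, y}})) \<le> \<mu> / 2} \<le> exp (- \<mu> / 16)"
      unfolding diff half \<open>exp (- \<mu> / 16) = _\<close>
    proof (rule chernoff_lower[OF finite_vertex_pairs fresh_props(1)
          determined_by_compose[OF determined_by_adjacent, where h=Not]
          disjoint_adjacent[OF fresh_props(3)]])
      fix x assume "x \<in> fresh n B L"
      then have "measure_pmf.prob (edge_pmf n p) {f. \<not> (\<exists>y\<in>L. f {x, y})} = (1 - p) ^ card L"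
        using BL p by (intro prob_not_adjacent) (auto simp: fresh_def)
      also have "\<dots> = (1 - p) powr real (card L)"
        using p by (simp add: powr_realpow)
      also have "\<dots> \<ge> (1 - p) powr t"
        using L p by (intro powr_mono') auto
      finally show "(1 - p) powr t \<le> measure_pmf.prob (edge_pmf n p) {f. \<not> (\<exists>y\<in>L. f {x, y})}" .
    next
      show "\<mu> \<le> real (card (fresh n B L)) * (1 - p) powr t"
        unfolding \<mu>_def using card_fresh_ge[OF BL(1,2) Q] by (intro mult_right_mono) auto
      show "0 \<le> \<mu>"
        unfolding \<mu>_def using t by simp
    qed auto
  qed auto
qed

subsection \<open>Distances and the query game\<close>

definition graph_of :: "nat \<Rightarrow> (nat set \<Rightarrow> bool) \<Rightarrow> nat graph" where
  "graph_of n f = ({1..n}, {e \<in> vertex_pairs n. f e})"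

lemma binomial_random_graph_eq: "binomial_random_graph n p = map_pmf (graph_of n) (edge_pmf n p)"
  unfolding binomial_random_graph_def graph_of_def ..

lemma adj_rel_graph_of:
  "(x, y) \<in> adj_rel (graph_of n f) \<longleftrightarrow> x \<noteq> y \<and> x \<in> {1..n} \<and> y \<in> {1..n} \<and> f {x, y}"
  by (auto simp: adj_rel_def graph_of_def vertex_pairs_def card_insert_if)

lemma mem_explored_iff_walk:
  assumes "S \<subseteq> {1..n}"
  shows "x \<in> explored n S f j \<longleftrightarrow> (\<exists>u\<in>S. \<exists>k<j. (u, x) \<in> adj_rel (graph_of n f) ^^ k)"
proof (induction j arbitrary: x rule: less_induct)
  case (less j)
  show ?case
  proof (cases j)
    case (Suc j)
    let ?A = "adj_rel (graph_of n f)"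
    \<comment> \<open>The hypothesis is needed at two levels: for round \<open>j\<close> and, when a
      walk is cut before its last edge, for the round before it.\<close>
    have IH: "y \<in> explored n S f j' \<longleftrightarrow> (\<exists>u\<in>S. \<exists>k<j'. (u, y) \<in> ?A ^^ k)" if "j' \<le> j" for y j'
      using less.IH[of j' y] that Suc by simp
    show ?thesis
      unfolding Suc
    proof
      assume "x \<in> explored n S f (Suc j)"
      then consider "x \<in> explored n S f j" | "x \<in> layer n S f j" by (auto simp: explored_Suc)
      then show "\<exists>u\<in>S. \<exists>k<Suc j. (u, x) \<in> ?A ^^ k"
      proof cases
        case 1
        then show ?thesis using IH[of j x] less_SucI by blast
      next
        case 2
        show ?thesis
        proof (cases j)
          case 0
          then show ?thesis using 2 by auto
        next
          case (Suc i)
          with 2 obtain y where y: "y \<in> layer n S f i" "f {x, y}" "x \<in> {1..n}"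
              "x \<notin> layer n S f i"
            by (auto simp: layer_Suc)
          have "y \<in> explored n S f j" using y by (auto simp: Suc explored_Suc)
          then obtain u k where uk: "u \<in> S" "k < j" "(u, y) \<in> ?A ^^ k" using IH[of j y] by auto
          have "(y, x) \<in> ?A"
            using y layer_subset[OF assms, of f i] by (auto simp: adj_rel_graph_of insert_commute)
          with uk have "(u, x) \<in> ?A ^^ Suc k" by auto
          then show ?thesis using uk by (meson Suc_mono)
        qed
      qed
    next
      assume "\<exists>u\<in>S. \<exists>k<Suc j. (u, x) \<in> ?A ^^ k"
      then obtain u k where uk: "u \<in> S" "k < Suc j" "(u, x) \<in> ?A ^^ k" by blast
      show "x \<in> explored n S f (Suc j)"
      proof (cases "k < j")
        case True
        then show ?thesis using uk IH[of j x] by (auto simp: explored_Suc)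
      next
        case False
        \<comment> \<open>For a walk of length exactly \<open>j\<close>, the vertex before the end
          was either found early, giving a shorter walk to \<open>x\<close>, or lies in layer
          \<open>j - 1\<close>, so that \<open>x\<close> is found in this round.\<close>
        then have [simp]: "k = j" using uk by simp
        show ?thesis
        proof (cases j)
          case 0
          then show ?thesis using uk by (simp add: explored_Suc)
        next
          case (Suc i)
          then obtain y where y: "(u, y) \<in> ?A ^^ i" "(y, x) \<in> ?A" using uk by auto
          have "y \<in> explored n S f j" using y uk IH[of j y] Suc by auto
          then consider "y \<in> explored n S f i" | "y \<in> layer n S f i" by (auto simp: Suc explored_Suc)
          then show ?thesis
          proof cases
            case 1
            then obtain u' k' where "u' \<in> S" "k' < i" "(u', y) \<in> ?A ^^ k'"
              using IH[of i y] Suc by auto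
            then have "(u', x) \<in> ?A ^^ Suc k'" "Suc k' < j" using y Suc by auto
            then have "x \<in> explored n S f j" using IH[of j x] \<open>u' \<in> S\<close> by blast
            then show ?thesis by (simp add: explored_Suc)
          next
            case 2
            have "x \<in> {1..n}" "f {x, y}" using y by (auto simp: adj_rel_graph_of insert_commute)
            with 2 show ?thesis by (auto simp: Suc explored_Suc layer_Suc)
          qed
        qed
      qed
    qed
  qed simp
qed

lemma Inf_enat_in: "Inf A \<in> A" if "A \<noteq> {}" for A :: "enat set"
proof -
  have "Inf A = (LEAST a. a \<in> A)" using that by (simp add: Inf_enat_def)
  moreover have "\<exists>a. a \<in> A" using that by blast
  ultimately show ?thesis using LeastI_ex[of "\<lambda>a. a \<in> A"] by simp
qed

lemma graph_dist_le_iff: "graph_dist G u x \<le> enat j \<longleftrightarrow> (\<exists>k\<le>j. (u, x) \<in> adj_rel G ^^ k)"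
proof
  assume le: "graph_dist G u x \<le> enat j"
  \<comment> \<open>A finite bound excludes the empty set of walk lengths, whose infimum is
    \<open>\<infinity>\<close>; hence the infimum is attained.\<close>
  have "{enat k |k. (u, x) \<in> adj_rel G ^^ k} \<noteq> {}"
  proof
    assume "{enat k |k. (u, x) \<in> adj_rel G ^^ k} = {}"
    then have "graph_dist G u x = \<infinity>" by (simp add: graph_dist_def top_enat_def)
    with le show False by simp
  qed
  then have "Inf {enat k |k. (u, x) \<in> adj_rel G ^^ k} \<in> {enat k |k. (u, x) \<in> adj_rel G ^^ k}"
    by (rule Inf_enat_in)
  then obtain k where "graph_dist G u x = enat k" "(u, x) \<in> adj_rel G ^^ k"
    unfolding graph_dist_def by blast
  with le show "\<exists>k\<le>j. (u, x) \<in> adj_rel G ^^ k" by auto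
next
  assume "\<exists>k\<le>j. (u, x) \<in> adj_rel G ^^ k"
  then obtain k where k: "k \<le> j" "(u, x) \<in> adj_rel G ^^ k" by blast
  then have "graph_dist G u x \<le> enat k" unfolding graph_dist_def by (intro Inf_lower) auto
  then show "graph_dist G u x \<le> enat j" using k order_trans enat_ord_simps(1) by blast
qed

text \<open>Note the shift: \<open>j + 1\<close> rounds explore layers 0 to \<open>j\<close>, the
  closed ball of radius \<open>j\<close>.\<close>

lemma mem_explored_iff_dist:
  assumes "u \<in> {1..n}"
  shows "x \<in> explored n {u} f (Suc j) \<longleftrightarrow> graph_dist (graph_of n f) u x \<le> enat j"
  using assms by (subst mem_explored_iff_walk) (auto simp: graph_dist_le_iff less_Suc_eq_le)

lemma graph_dist_eqI:
  assumes "u \<in> {1..n}" "x \<notin> explored n {u} f (Suc j)" "x \<in> explored n {u} f (Suc (Suc j))"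
  shows "graph_dist (graph_of n f) u x = enat (Suc j)"
proof (rule antisym)
  show "graph_dist (graph_of n f) u x \<le> enat (Suc j)"
    using assms(3) unfolding mem_explored_iff_dist[OF assms(1)] .
  have "enat j < graph_dist (graph_of n f) u x"
    using assms(2) unfolding mem_explored_iff_dist[OF assms(1)] by simp
  then show "enat (Suc j) \<le> graph_dist (graph_of n f) u x"
    by (simp add: Suc_ile_eq)
qed

text \<open>Individual layers of a set need not be unions of layers of its elements, but balls are.
  This bounds the ball around all queried vertices by the balls around single ones.\<close>

lemma explored_UN:
  assumes "S \<subseteq> {1..n}"
  shows "explored n S f j = (\<Union>u\<in>S. explored n {u} f j)"
proof (rule set_eqI)
  fix x
  have "x \<in> explored n {u} f j \<longleftrightarrow> (\<exists>k<j. (u, x) \<in> adj_rel (graph_of n f) ^^ k)" if "u \<in> S" for u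
    using that assms by (subst mem_explored_iff_walk) auto
  then show "x \<in> explored n S f j \<longleftrightarrow> x \<in> (\<Union>u\<in>S. explored n {u} f j)"
    using assms by (auto simp: mem_explored_iff_walk)
qed

text \<open>An adversary who always names the first vertex of the query follows a single branch of
  the algorithm, on which at most \<open>2 * t\<close> vertices occur. Two targets, each equidistant
  from all of these, make every such reply truthful and are never separated.\<close>

lemma not_locates_within:
  assumes *: "\<And>S. S \<subseteq> verts G \<Longrightarrow> finite S \<Longrightarrow> card S \<le> 2 * t \<Longrightarrow>
      \<exists>x\<in>verts G. \<exists>y\<in>verts G. x \<noteq> y \<and>
        (\<forall>u\<in>S. \<forall>v\<in>S. graph_dist G u x = graph_dist G v x \<and> graph_dist G u y = graph_dist G v y)"
  shows "\<not> locates_within G (verts G \<times> verts G) \<sigma> t"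
proof
  assume loc: "locates_within G (verts G \<times> verts G) \<sigma> t"
  \<comment> \<open>This branch depends on \<open>\<sigma>\<close> alone, so the set
    \<open>S\<close> of queried vertices is fixed before \<open>x\<close> and \<open>y\<close> are
    chosen.\<close>
  define rs where "rs = rec_nat [] (\<lambda>_ r. r @ [fst (\<sigma> r)])"
  have rs_0: "rs 0 = []" and rs_Suc: "rs (Suc j) = rs j @ [fst (\<sigma> (rs j))]" for j
    by (simp_all add: rs_def)
  have len: "length (rs j) = j" for j by (induction j) (simp_all add: rs_0 rs_Suc)
  have take: "take l (rs j) = rs l" if "l \<le> j" for l j
    using that
  proof (induction j)
    case (Suc j)
    then show ?case
      by (cases "l = Suc j") (auto simp: rs_Suc len)
  qed (simp add: rs_0)
  have nth: "rs j ! l = fst (\<sigma> (rs l))" if "l < j" for l j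
  proof -
    have "rs j ! l = take (Suc l) (rs j) ! l" by simp
    also have "\<dots> = rs (Suc l) ! l" using take[of "Suc l" j] that by simp
    also have "\<dots> = fst (\<sigma> (rs l))" by (simp add: rs_Suc nth_append len)
    finally show ?thesis .
  qed
  define S where "S = fst ` (\<lambda>j. \<sigma> (rs j)) ` {..<t} \<union> snd ` (\<lambda>j. \<sigma> (rs j)) ` {..<t}"
  have "\<sigma> (rs j) \<in> verts G \<times> verts G" if "j < t" for j
    using loc that len[of j] unfolding locates_within_def by metis
  then have "S \<subseteq> verts G" unfolding S_def by fastforce
  moreover have "finite S" by (simp add: S_def)
  moreover have "card S \<le> 2 * t"
  proof -
    have "card (g ` (\<lambda>j. \<sigma> (rs j)) ` {..<t}) \<le> t" for g :: "'a \<times> 'a \<Rightarrow> 'a"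
      by (metis card_image_le card_lessThan finite_lessThan image_image)
    from this[of fst] this[of snd] show ?thesis
      unfolding S_def using card_Un_le[of "fst ` (\<lambda>j. \<sigma> (rs j)) ` {..<t}" "snd ` (\<lambda>j. \<sigma> (rs j)) ` {..<t}"]
      by linarith
  qed
  ultimately obtain x y where xy: "x \<in> verts G" "y \<in> verts G" "x \<noteq> y"
    and eq: "\<And>u v. u \<in> S \<Longrightarrow> v \<in> S \<Longrightarrow>
      graph_dist G u x = graph_dist G v x \<and> graph_dist G u y = graph_dist G v y"
    using *[of S] by blast
  have legal: "fst (\<sigma> (rs j)) \<in> legal_replies G (\<sigma> (rs j)) z" if "j < t" "z \<in> {x, y}" for j z
  proof -
    have "fst (\<sigma> (rs j)) \<in> S" "snd (\<sigma> (rs j)) \<in> S" using that by (auto simp: S_def)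
    from eq[OF this] that(2) show ?thesis
      by (auto simp: legal_replies_def split: prod.split)
  qed
  have cand: "{x, y} \<subseteq> candidates G \<sigma> (take s (rs t))" if "s \<le> t" for s
    using that xy legal by (auto simp: candidates_def take len nth)
  have "x \<in> candidates G \<sigma> (rs t)" using cand[of t] by (simp add: take)
  then obtain s where s: "s \<le> t" "card (candidates G \<sigma> (take s (rs t))) = 1"
    using loc xy(1) len[of t] unfolding locates_within_def by blast
  then obtain z where "candidates G \<sigma> (take s (rs t)) = {z}" by (auto simp: card_1_singleton_iff)
  with cand[OF s(1)] xy(3) show False by auto
qed

lemma query_number_ge:
  assumes "\<And>t \<sigma>. real t < c \<Longrightarrow> \<not> locates_within G Q \<sigma> t"
  shows "ereal c \<le> ereal_of_enat (query_number G Q)"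
proof -
  have "enat (nat \<lceil>c\<rceil>) \<le> query_number G Q"
    unfolding query_number_def
  proof (rule Inf_greatest)
    fix a assume "a \<in> {enat t |t. \<exists>\<sigma>. locates_within G Q \<sigma> t}"
    then obtain t \<sigma> where "a = enat t" "locates_within G Q \<sigma> t" by blast
    with assms[of t \<sigma>] have "c \<le> real t" "a = enat t" by (auto simp: not_less[symmetric])
    then show "enat (nat \<lceil>c\<rceil>) \<le> a" by (simp add: ceiling_le_iff nat_le_iff)
  qed
  then have "ereal_of_enat (enat (nat \<lceil>c\<rceil>)) \<le> ereal_of_enat (query_number G Q)"
    by (simp only: ereal_of_enat_le_iff)
  moreover have "ereal c \<le> ereal_of_enat (enat (nat \<lceil>c\<rceil>))"
    by (simp add: real_nat_ceiling_ge)
  ultimately show ?thesis by (rule order_trans[rotated])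
qed

lemma locates_within_mono: "locates_within G Q \<sigma> t \<Longrightarrow> Q \<subseteq> R \<Longrightarrow> locates_within G R \<sigma> t"
  by (auto simp: locates_within_def)

lemma pq_number_le_eq_number:
  assumes "adj_rel G \<subseteq> verts G \<times> verts G"
  shows "pq_number G \<le> eq_number G"
  unfolding pq_number_def eq_number_def query_number_def
  using assms by (intro Inf_superset_mono) (auto intro: locates_within_mono)

subsection \<open>Concentration of the layers\<close>

lemma sum_power_le:
  fixes d :: real
  assumes "2 \<le> d"
  shows "(\<Sum>l<j. d ^ l) * (d - 1) \<le> d ^ j"
  using power_diff_1_eq[of d j] by (simp add: mult.commute)

text \<open>The condition on \<open>\<epsilon>\<^sup>2 * d\<close> brings each Chernoff failure for
  a single layer down to \<open>1 / n ^ 3\<close>; the bound on \<open>d ^ i\<close> keeps the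
  explored part a small fraction of all vertices.\<close>

locale exploration =
  fixes n i :: nat and p d \<epsilon> :: real
  assumes n_pos: "1 \<le> n" and p: "0 \<le> p" "p < 1" and d: "d = p * real n" and d_ge: "4 \<le> d"
    and eps: "0 < \<epsilon>" "\<epsilon> \<le> 1 / 8" and eps_d: "48 * ln (real n) \<le> \<epsilon>\<^sup>2 * d"
    and d_i: "d ^ i \<le> real n / 16"
begin

text \<open>Layer \<open>j + 1\<close> is allowed an additional relative error
  \<open>\<epsilon> / 2 ^ j\<close>. These errors add up to
  \<open>2 * \<epsilon> * (1 - 1 / 2 ^ l)\<close>, and doubling the sum absorbs the products of the
  error factors.\<close>

definition up :: "nat \<Rightarrow> real" where
  "up l = d ^ l * (1 + 4 * \<epsilon> * (1 - 1 / 2 ^ l))"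

text \<open>The last term of \<open>\<beta>\<close> accounts for the vertices already explored and for pairs of edges
  with the same end point.\<close>

definition \<beta> :: "nat \<Rightarrow> real" where
  "\<beta> l = 1 - 2 * \<epsilon> * (1 - 1 / 2 ^ l) - 4 * d ^ l / real n"

definition good :: "nat \<Rightarrow> (nat set \<Rightarrow> bool) \<Rightarrow> nat \<Rightarrow> bool" where
  "good u f j \<longleftrightarrow> (\<forall>l\<le>j. d ^ l * \<beta> l \<le> real (card (layer n {u} f l)) \<and>
     real (card (layer n {u} f l)) \<le> up l)"

lemma d_pow_le: "l \<le> i \<Longrightarrow> d ^ l \<le> real n / 16"
  using d_i d_ge power_increasing[of l i d] by linarith

lemma beta_bounds:
  assumes "l \<le> i"
  shows "1 / 2 \<le> \<beta> l" "\<beta> l \<le> 1"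
proof -
  have e: "0 \<le> \<epsilon> * (1 - 1 / 2 ^ l)" "\<epsilon> * (1 - 1 / 2 ^ l) \<le> 1 / 8 * 1"
    using eps by (simp, intro mult_mono) auto
  have "4 * d ^ l / real n \<le> 1 / 4" using d_pow_le[OF assms] n_pos by (simp add: field_simps)
  then show "1 / 2 \<le> \<beta> l" using e unfolding \<beta>_def by linarith
  have "0 \<le> 4 * d ^ l / real n" using d_ge by simp
  then show "\<beta> l \<le> 1" using e unfolding \<beta>_def by linarith
qed

lemma up_bounds: "d ^ l \<le> up l" "up l \<le> d ^ l * (1 + 4 * \<epsilon>)" "up l \<le> 2 * d ^ l"
proof -
  have "d ^ l * 1 \<le> up l"
    unfolding up_def using eps d_ge by (intro mult_left_mono) auto
  then show "d ^ l \<le> up l" by simp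
  show le: "up l \<le> d ^ l * (1 + 4 * \<epsilon>)"
    unfolding up_def using eps d_ge by (intro mult_left_mono add_left_mono) auto
  have "d ^ l * (1 + 4 * \<epsilon>) \<le> d ^ l * 2"
    using eps d_ge by (intro mult_left_mono) auto
  with le show "up l \<le> 2 * d ^ l" by simp
qed

lemma card_explored_le:
  assumes "good u f j"
  shows "real (card (explored n {u} f (Suc j))) \<le> (\<Sum>l<Suc j. up l)"
proof -
  have "real (card (explored n {u} f (Suc j))) \<le> real (\<Sum>l<Suc j. card (layer n {u} f l))"
    unfolding explored_eq_UN of_nat_le_iff by (rule card_UN_le) simp
  also have "\<dots> \<le> (\<Sum>l<Suc j. up l)"
    using assms unfolding of_nat_sum by (intro sum_mono) (auto simp: good_def)
  finally show ?thesis .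
qed

lemma sum_up_le: "(\<Sum>l<Suc j. up l) \<le> d ^ Suc j"
proof -
  have "(\<Sum>l<Suc j. up l) \<le> (\<Sum>l<Suc j. 2 * d ^ l)"
    by (intro sum_mono up_bounds)
  also have "\<dots> = 2 * (\<Sum>l<Suc j. d ^ l)" by (simp only: sum_distrib_left)
  also have "\<dots> \<le> (\<Sum>l<Suc j. d ^ l) * (d - 1)"
    using d_ge by (subst mult.commute) (intro mult_left_mono sum_nonneg, auto)
  also have "\<dots> \<le> d ^ Suc j" using d_ge by (intro sum_power_le) auto
  finally show ?thesis .
qed

text \<open>Halving the error costs a factor 4 per layer, while the layer grows by
  \<open>d \<ge> 4\<close>, so the Chernoff exponent never falls below its value in the first
  round.\<close>

lemma exponent_bound: "48 * ln (real n) \<le> (\<epsilon> / 2 ^ j)\<^sup>2 * d ^ Suc j"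
proof -
  have "(4::real) ^ j = 2 ^ j * 2 ^ j" by (simp flip: power_mult_distrib)
  then have eq: "(\<epsilon> / 2 ^ j)\<^sup>2 * d ^ Suc j = \<epsilon>\<^sup>2 * d * (d / 4) ^ j"
    by (simp add: power2_eq_square power_divide)
  have "1 \<le> (d / 4) ^ j" using d_ge by (intro one_le_power) auto
  then have "\<epsilon>\<^sup>2 * d * 1 \<le> \<epsilon>\<^sup>2 * d * (d / 4) ^ j"
    using d_ge by (intro mult_left_mono) auto
  then show ?thesis unfolding eq using eps_d by linarith
qed

text \<open>Once the layers up to \<open>j\<close> are good, the next one leaves its window only if
  one of two Chernoff events occurs, each of probability at most \<open>1 / n ^ 3\<close>.\<close>

lemma prob_not_good:
  assumes u: "u \<in> {1..n}" and "j \<le> i"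
  shows "measure_pmf.prob (edge_pmf n p) {f. \<not> good u f j} \<le> 2 * real j * exp (- 3 * ln (real n))"
  using assms(2)
proof (induction j)
  case 0
  have "4 * \<epsilon> * (1 - 1 / 2 ^ 0) = 0" "\<beta> 0 \<le> 1" using beta_bounds[of 0] by auto
  then have "good u f 0" for f
    by (simp add: good_def up_def)
  then show ?case by simp
next
  case (Suc j)
  let ?M = "edge_pmf n p"
  define \<delta> where "\<delta> = \<epsilon> / 2 ^ j"
  have "\<epsilon> / 2 ^ j \<le> \<epsilon> / 1" using eps by (intro divide_left_mono) auto
  then have \<delta>: "0 \<le> \<delta>" "\<delta> \<le> 1 / 8" unfolding \<delta>_def using eps by (simp, linarith)
  have p1: "p \<le> 1" using p by simp
  have ln0: "0 \<le> ln (real n)" using n_pos by simp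
  \<comment> \<open>The expected fraction of vertices in the next layer. Both sources of loss,
    vertices already explored and several edges to the same vertex, are measured by
    \<open>y\<close>.\<close>
  define y where "y = d ^ Suc j / real n"
  have y: "0 \<le> y" "y \<le> 1 / 16"
    using d_pow_le[of "Suc j"] Suc.prems d_ge n_pos by (auto simp: y_def field_simps)
  have ny: "real n * y = d ^ Suc j" using n_pos by (simp add: y_def)
  have b: "1 / 2 \<le> \<beta> j" "\<beta> j \<le> 1" using beta_bounds[of j] Suc.prems by auto
  define m where "m = d ^ j * \<beta> j"
  define K where "K = d ^ Suc j"
  define \<mu> where "\<mu> = (real n - K) * (1 - exp (- (p * m)))"
  have pm: "p * m = \<beta> j * y"
    using n_pos by (simp add: m_def y_def d)
  have m0: "0 \<le> m" using b d_ge by (simp add: m_def)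
  have K: "K \<le> real n" using d_pow_le[of "Suc j"] Suc.prems unfolding K_def by linarith
  have by1: "0 \<le> \<beta> j * y" "\<beta> j * y \<le> y"
    using b y mult_right_mono[of "\<beta> j" 1 y] by auto
  \<comment> \<open>Coinciding end points cost a factor \<open>1 - y\<close> and the explored
    vertices another one, whence the square below.\<close>
  have "exp (- (\<beta> j * y)) \<le> 1 - \<beta> j * y + (\<beta> j * y)\<^sup>2"
    by (rule exp_minus_le_quadratic[OF by1(1)])
  also have "\<dots> \<le> 1 - \<beta> j * y + \<beta> j * y * y"
    using by1 by (simp add: power2_eq_square mult_left_mono)
  finally have "\<beta> j * y * (1 - y) \<le> 1 - exp (- (p * m))"
    unfolding pm by (simp add: algebra_simps)
  then have "real n * (1 - y) * (\<beta> j * y * (1 - y)) \<le> real n * (1 - y) * (1 - exp (- (p * m)))"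
    using y by (intro mult_left_mono) auto
  also have "\<dots> = \<mu>" unfolding \<mu>_def K_def ny[symmetric] by (simp add: algebra_simps)
  also have "real n * (1 - y) * (\<beta> j * y * (1 - y)) = d ^ Suc j * (\<beta> j * (1 - y)\<^sup>2)"
    unfolding ny[symmetric] by (simp add: power2_eq_square)
  finally have "d ^ Suc j * (\<beta> j * (1 - y)\<^sup>2) \<le> \<mu>" .
  moreover have "1 - 2 * y \<le> (1 - y)\<^sup>2" by (simp add: power2_eq_square algebra_simps)
  then have "d ^ Suc j * (\<beta> j * (1 - 2 * y)) \<le> d ^ Suc j * (\<beta> j * (1 - y)\<^sup>2)"
    using b d_ge by (intro mult_left_mono) auto
  ultimately have \<mu>: "d ^ Suc j * (\<beta> j * (1 - 2 * y)) \<le> \<mu>" by linarith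
  have large: "measure_pmf.prob ?M {f. real (card (layer n {u} f j)) \<le> up j \<and>
      (1 + \<delta>) * (real n * p * up j) \<le> real (card (layer n {u} f (Suc j)))}
      \<le> exp (- 3 * ln (real n))"
  proof -
    have "real n * p * up j \<ge> d ^ Suc j"
      using up_bounds(1)[of j] d_ge by (simp add: d[symmetric] mult.commute[of "real n"] mult_left_mono)
    then have "\<delta>\<^sup>2 * d ^ Suc j \<le> \<delta>\<^sup>2 * (real n * p * up j)" by (intro mult_left_mono) auto
    then have "- \<delta>\<^sup>2 * (real n * p * up j) / 4 \<le> - 3 * ln (real n)"
      using exponent_bound[of j] ln0 unfolding \<delta>_def by linarith
    then show ?thesis
      using \<delta> u by (intro order_trans[OF prob_next_layer_large[OF _ p(1) p1]]) auto
  qed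
  have small: "measure_pmf.prob ?M
      {f. (real (card (explored n {u} f j \<union> layer n {u} f j)) \<le> K \<and> m \<le> real (card (layer n {u} f j))) \<and>
          real (card (layer n {u} f (Suc j))) \<le> (1 - \<delta>) * \<mu>} \<le> exp (- 3 * ln (real n))"
  proof -
    \<comment> \<open>Thus \<open>\<mu>\<close> is at least a quarter of \<open>d ^ Suc j\<close>.
      With the 4 of the Chernoff exponent and the target exponent 3 this accounts for the constant
      48 of the locale.\<close>
    have "1 / 2 * (7 / 8) \<le> \<beta> j * (1 - 2 * y)" using b y by (intro mult_mono) auto
    then have "d ^ Suc j * (1 / 4) \<le> d ^ Suc j * (\<beta> j * (1 - 2 * y))"
      using d_ge by (intro mult_left_mono) auto
    then have "\<delta>\<^sup>2 * (d ^ Suc j * (1 / 4)) \<le> \<delta>\<^sup>2 * \<mu>" using \<mu> by (intro mult_left_mono) auto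
    then have "- \<delta>\<^sup>2 * \<mu> / 4 \<le> - 3 * ln (real n)"
      using exponent_bound[of j] ln0 unfolding \<delta>_def by simp
    then show ?thesis
      unfolding \<mu>_def using \<delta> u m0 K
      by (intro order_trans[OF prob_next_layer_small[OF _ p(1) p1]]) auto
  qed
  have up_Suc: "(1 + \<delta>) * (real n * p * up j) \<le> up (Suc j)"
  proof -
    define X where "X = 4 * \<epsilon> * (1 - 1 / 2 ^ j)"
    have "X \<le> 4 * \<epsilon> * 1" unfolding X_def using eps by (intro mult_left_mono) auto
    then have "\<delta> * (1 + X) \<le> \<delta> * 2" using \<delta> eps by (intro mult_left_mono) auto
    then have "(1 + \<delta>) * (1 + X) \<le> 1 + X + 2 * \<delta>" by (simp add: algebra_simps)
    also have "\<dots> = 1 + 4 * \<epsilon> * (1 - 1 / 2 ^ Suc j)" by (simp add: \<delta>_def X_def field_simps)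
    finally have "d ^ Suc j * ((1 + \<delta>) * (1 + X)) \<le> up (Suc j)"
      unfolding up_def using d_ge by (intro mult_left_mono) auto
    then show ?thesis by (simp add: up_def X_def d[symmetric] mult_ac)
  qed
  have lo_Suc: "d ^ Suc j * \<beta> (Suc j) \<le> (1 - \<delta>) * \<mu>"
  proof -
    \<comment> \<open>As \<open>d \<ge> 4\<close>, the last term of \<open>\<beta>\<close> grows by
      at least \<open>3 * y\<close> in this round, which pays for the loss
      \<open>2 * y\<close>.\<close>
    have "4 * d ^ j / real n \<le> y"
    proof -
      have "4 * d ^ j \<le> d * d ^ j" using d_ge by (intro mult_right_mono) auto
      then show ?thesis unfolding y_def using n_pos by (simp add: divide_right_mono)
    qed
    moreover have "\<beta> (Suc j) = \<beta> j + 4 * d ^ j / real n - \<delta> - 4 * y"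
      by (simp add: \<beta>_def \<delta>_def y_def field_simps)
    ultimately have "\<beta> (Suc j) \<le> \<beta> j - \<delta> - 2 * y" using y by linarith
    also have "\<dots> \<le> \<beta> j - (\<delta> + 2 * y) * \<beta> j"
      using \<delta> y b mult_left_mono[of "\<beta> j" 1 "\<delta> + 2 * y"] by simp
    also have "\<dots> \<le> (1 - \<delta>) * (\<beta> j * (1 - 2 * y))"
      using \<delta> y b by (simp add: algebra_simps)
    finally have "d ^ Suc j * \<beta> (Suc j) \<le> d ^ Suc j * ((1 - \<delta>) * (\<beta> j * (1 - 2 * y)))"
      using d_ge by (intro mult_left_mono) auto
    also have "\<dots> = (1 - \<delta>) * (d ^ Suc j * (\<beta> j * (1 - 2 * y)))" by (simp add: mult_ac)
    also have "\<dots> \<le> (1 - \<delta>) * \<mu>" using \<mu> \<delta> by (intro mult_left_mono) auto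
    finally show ?thesis .
  qed
  let ?A = "{f. real (card (layer n {u} f j)) \<le> up j \<and>
      (1 + \<delta>) * (real n * p * up j) \<le> real (card (layer n {u} f (Suc j)))}"
  let ?B = "{f. (real (card (explored n {u} f j \<union> layer n {u} f j)) \<le> K \<and> m \<le> real (card (layer n {u} f j))) \<and>
          real (card (layer n {u} f (Suc j))) \<le> (1 - \<delta>) * \<mu>}"
  have "{f. \<not> good u f (Suc j)} \<subseteq> {f. \<not> good u f j} \<union> (?A \<union> ?B)"
  proof
    fix f assume "f \<in> {f. \<not> good u f (Suc j)}"
    then have ng: "\<not> good u f (Suc j)" by simp
    show "f \<in> {f. \<not> good u f j} \<union> (?A \<union> ?B)"
    proof (cases "good u f j")
      case True
      have "real (card (explored n {u} f j \<union> layer n {u} f j)) \<le> K"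
        unfolding explored_Suc[symmetric] K_def using card_explored_le[OF True] sum_up_le[of j] by linarith
      moreover have "m \<le> real (card (layer n {u} f j))" "real (card (layer n {u} f j)) \<le> up j"
        using True by (auto simp: good_def m_def)
      moreover have "\<not> (d ^ Suc j * \<beta> (Suc j) \<le> real (card (layer n {u} f (Suc j))) \<and>
          real (card (layer n {u} f (Suc j))) \<le> up (Suc j))"
        using ng True unfolding good_def le_Suc_eq by blast
      then have "real (card (layer n {u} f (Suc j))) \<le> (1 - \<delta>) * \<mu> \<or>
          (1 + \<delta>) * (real n * p * up j) \<le> real (card (layer n {u} f (Suc j)))"
        using up_Suc lo_Suc by linarith
      ultimately show ?thesis by blast
    qed simp
  qed
  then have "measure_pmf.prob ?M {f. \<not> good u f (Suc j)} \<le>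
      measure_pmf.prob ?M ({f. \<not> good u f j} \<union> (?A \<union> ?B))"
    by (intro measure_pmf.finite_measure_mono) auto
  also have "\<dots> \<le> measure_pmf.prob ?M {f. \<not> good u f j} +
      (measure_pmf.prob ?M ?A + measure_pmf.prob ?M ?B)"
    by (intro order_trans[OF measure_Un_le] add_left_mono
        measure_Un_le) auto
  also have "\<dots> \<le> 2 * real j * exp (- 3 * ln (real n)) +
      (exp (- 3 * ln (real n)) + exp (- 3 * ln (real n)))"
    using Suc.prems by (intro add_mono Suc.IH large small) auto
  also have "\<dots> = 2 * real (Suc j) * exp (- 3 * ln (real n))"
    by (simp add: algebra_simps)
  finally show ?case .
qed

text \<open>This crude bound suffices: \<open>n\<close> starting vertices with at most
  \<open>2 * n\<close> failures of probability \<open>1 / n ^ 3\<close> each give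
  \<open>2 / n\<close> in total.\<close>

lemma i_le: "real i \<le> real n"
proof -
  have "1 + real i * 1 \<le> (1 + 1) ^ i" by (rule Bernoulli_inequality) simp
  also have "\<dots> \<le> d ^ i" using d_ge by (intro power_mono) auto
  finally show ?thesis using d_i by linarith
qed

lemma prob_some_not_good:
  "measure_pmf.prob (edge_pmf n p) {f. \<exists>u\<in>{1..n}. \<not> good u f i} \<le> 2 / real n"
proof -
  have "{f. \<exists>u\<in>{1..n}. \<not> good u f i} = (\<Union>u\<in>{1..n}. {f. \<not> good u f i})" by auto
  then have "measure_pmf.prob (edge_pmf n p) {f. \<exists>u\<in>{1..n}. \<not> good u f i} \<le>
      (\<Sum>u\<in>{1..n}. measure_pmf.prob (edge_pmf n p) {f. \<not> good u f i})"
    by (simp only:) (rule measure_pmf.finite_measure_subadditive_finite, auto)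
  also have "\<dots> \<le> (\<Sum>u\<in>{1..n}. 2 * real n * exp (- 3 * ln (real n)))"
    using i_le by (intro sum_mono order_trans[OF prob_not_good]) (auto intro!: mult_right_mono)
  also have "\<dots> = 2 * (real n * real n * exp (- 3 * ln (real n)))" by simp
  also have "exp (- 3 * ln (real n)) = inverse (real n ^ 3)"
    using n_pos exp_of_nat_mult[of 3 "ln (real n)"] by (simp add: exp_minus)
  also have "2 * (real n * real n * inverse (real n ^ 3)) = 2 / real n"
    using n_pos by (simp add: field_simps power3_eq_cube)
  finally show ?thesis .
qed

section \<open>Vertices too far from some vertex, and vertices left uncovered by the queries\<close>

definition unreached :: "(nat set \<Rightarrow> bool) \<Rightarrow> nat set" where
  "unreached f = {x \<in> {1..n}. \<exists>u\<in>{1..n}. x \<notin> explored n {u} f (Suc (Suc i))}"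

text \<open>First moment over ordered pairs \<open>(u, x)\<close> where layer \<open>i\<close> of
  \<open>u\<close> is large but \<open>x\<close> is missed. Every unreached vertex is the second
  component of such a pair, so there are at least as many pairs.\<close>

lemma prob_many_unreached:
  assumes "0 < c"
  shows "measure_pmf.prob (edge_pmf n p)
           {f. (\<forall>u\<in>{1..n}. good u f i) \<and> c \<le> real (card (unreached f))}
         \<le> real n ^ 2 * exp (- (p * (d ^ i * \<beta> i))) / c"
proof -
  let ?M = "edge_pmf n p"
  let ?V2 = "{1..n} \<times> {1..n}"
  define R where "R = (\<lambda>(u, x). {f. d ^ i * \<beta> i \<le> real (card (layer n {u} f i)) \<and>
      x \<notin> explored n {u} f (Suc (Suc i))})"
  have sum: "(\<Sum>z\<in>?V2. indicator (R z) f :: real) = real (card {z \<in> ?V2. f \<in> R z})" for f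
    by (simp add: indicator_def sum.If_cases Int_def)
  have "{f. (\<forall>u\<in>{1..n}. good u f i) \<and> c \<le> real (card (unreached f))} \<subseteq>
      {f. c \<le> (\<Sum>z\<in>?V2. indicator (R z) f)}"
  proof (intro Collect_mono impI)
    fix f assume f: "(\<forall>u\<in>{1..n}. good u f i) \<and> c \<le> real (card (unreached f))"
    have "x \<in> snd ` {z \<in> ?V2. f \<in> R z}" if x: "x \<in> unreached f" for x
    proof -
      obtain u where u: "u \<in> {1..n}" "x \<notin> explored n {u} f (Suc (Suc i))" and "x \<in> {1..n}"
        using x by (auto simp: unreached_def)
      then have "(u, x) \<in> {z \<in> ?V2. f \<in> R z}" using f by (auto simp: R_def good_def)
      then show ?thesis by force
    qed
    then have "card (unreached f) \<le> card {z \<in> ?V2. f \<in> R z}"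
      by (intro surj_card_le[where f=snd]) auto
    then show "c \<le> (\<Sum>z\<in>?V2. indicator (R z) f)"
      unfolding sum using f by linarith
  qed
  then have "measure_pmf.prob ?M {f. (\<forall>u\<in>{1..n}. good u f i) \<and> c \<le> real (card (unreached f))} \<le>
      measure_pmf.prob ?M {f. c \<le> (\<Sum>z\<in>?V2. indicator (R z) f)}"
    by (intro measure_pmf.finite_measure_mono) auto
  also have "\<dots> \<le> measure_pmf.expectation ?M (\<lambda>f. \<Sum>z\<in>?V2. indicator (R z) f) / c"
    using assms by (intro markov_pmf finite_set_Pi_pmf_bool sum_nonneg) auto
  also have "measure_pmf.expectation ?M (\<lambda>f. \<Sum>z\<in>?V2. indicator (R z) f) =
      (\<Sum>z\<in>?V2. measure_pmf.prob ?M (R z))"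
    by (subst Bochner_Integration.integral_sum)
       (rule integrable_measure_pmf_finite[OF finite_set_Pi_pmf_bool[OF finite_vertex_pairs]], simp)
  also have "\<dots> \<le> (\<Sum>z\<in>?V2. exp (- (p * (d ^ i * \<beta> i))))"
    unfolding R_def using p by (intro sum_mono) (auto intro!: prob_not_reached)
  also have "\<dots> = real n ^ 2 * exp (- (p * (d ^ i * \<beta> i)))"
    by (simp add: power2_eq_square)
  finally show ?thesis using assms by (simp add: divide_right_mono)
qed

text \<open>The threshold is half of a lower bound for the expected number of vertices that the ball
  of radius \<open>i\<close> misses, provided that the ball of radius \<open>i - 1\<close> has at
  most \<open>t\<close> vertices.\<close>

definition badly_covered :: "real \<Rightarrow> (nat set \<Rightarrow> bool) \<Rightarrow> nat set \<Rightarrow> bool" where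
  "badly_covered t f S \<longleftrightarrow> real (card (explored n S f i)) \<le> t \<and>
     real (card ({1..n} - explored n S f (Suc i))) \<le> (real n - t) * (1 - p) powr t / 2"

lemma prob_badly_covered:
  assumes "1 \<le> i" "t \<le> real n"
  shows "measure_pmf.prob (edge_pmf n p)
           {f. \<exists>xs. length xs = s \<and> set xs \<subseteq> {1..n} \<and> badly_covered t f (set xs)}
         \<le> real n ^ s * exp (- ((real n - t) * (1 - p) powr t) / 16)"
proof -
  let ?X = "{xs. set xs \<subseteq> {1..n} \<and> length xs = s}"
  have fin: "finite ?X" by (rule finite_lists_length_eq) simp
  have "{f. \<exists>xs. length xs = s \<and> set xs \<subseteq> {1..n} \<and> badly_covered t f (set xs)} =
      (\<Union>xs\<in>?X. {f. badly_covered t f (set xs)})" by auto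
  then have "measure_pmf.prob (edge_pmf n p)
      {f. \<exists>xs. length xs = s \<and> set xs \<subseteq> {1..n} \<and> badly_covered t f (set xs)} \<le>
      (\<Sum>xs\<in>?X. measure_pmf.prob (edge_pmf n p) {f. badly_covered t f (set xs)})"
    by (simp only:) (rule measure_pmf.finite_measure_subadditive_finite, use fin in auto)
  also have "\<dots> \<le> (\<Sum>xs\<in>?X. exp (- ((real n - t) * (1 - p) powr t) / 16))"
  proof (rule sum_mono)
    fix xs assume xs: "xs \<in> ?X"
    \<comment> \<open>The ball of radius \<open>i - 1\<close> is the union of the explored set and
      the layer after \<open>j\<close> rounds, the form needed in
      \<open>prob_few_uncovered\<close>.\<close>
    obtain j where j: "i = Suc j" using assms(1) by (cases i) auto
    show "measure_pmf.prob (edge_pmf n p) {f. badly_covered t f (set xs)} \<le>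
        exp (- ((real n - t) * (1 - p) powr t) / 16)"
      unfolding badly_covered_def unfolding j explored_Suc[of _ _ _ j]
      using xs p assms(2) by (intro prob_few_uncovered) auto
  qed
  also have "\<dots> = real n ^ s * exp (- ((real n - t) * (1 - p) powr t) / 16)"
    by (simp add: card_lists_length_eq)
  finally show ?thesis .
qed

text \<open>A vertex that is reached from all vertices within \<open>i + 1\<close> steps, but from no queried
  vertex within \<open>i\<close> steps, is equidistant from all queried vertices.\<close>

lemma not_located:
  assumes good: "\<And>u. u \<in> {1..n} \<Longrightarrow> good u f i" and i: "1 \<le> i"
    and unreached: "real (card (unreached f)) < c"
    and cov: "\<And>xs. length xs = s \<Longrightarrow> set xs \<subseteq> {1..n} \<Longrightarrow> \<not> badly_covered t f (set xs)"
    and t: "real s * (\<Sum>l<i. up l) \<le> t" and c: "c + 2 \<le> (real n - t) * (1 - p) powr t / 2"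
    and q: "2 * q \<le> s"
  shows "\<not> locates_within (graph_of n f) (verts (graph_of n f) \<times> verts (graph_of n f)) \<sigma> q"
proof (rule not_locates_within)
  fix S assume S: "S \<subseteq> verts (graph_of n f)" "finite S" "card S \<le> 2 * q"
  have SV: "S \<subseteq> {1..n}" using S by (simp add: graph_of_def)
  obtain ys where ys: "set ys = S" "length ys = card S"
    using S(2) by (metis distinct_card finite_distinct_list)
  \<comment> \<open>Padding with vertex 1 gives a list of length exactly \<open>s\<close>, as in the
    union bound over \<open>n ^ s\<close> lists. A larger set only makes the conclusion for
    \<open>S\<close> stronger.\<close>
  define xs where "xs = ys @ replicate (s - card S) 1"
  have len: "length xs = s" using S(3) q by (simp add: xs_def ys)
  have set: "set xs \<subseteq> {1..n}" using SV n_pos by (auto simp: xs_def ys)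
  have Sxs: "S \<subseteq> set xs" by (auto simp: xs_def ys)
  obtain j where j: "i = Suc j" using i by (cases i) auto
  have sum0: "0 \<le> (\<Sum>l<i. up l)"
    by (intro sum_nonneg order_trans[OF _ up_bounds(1)]) (use d_ge in auto)
  have "real (card (explored n (set xs) f i)) \<le> real (\<Sum>u\<in>set xs. card (explored n {u} f i))"
    unfolding explored_UN[OF set] of_nat_le_iff by (rule card_UN_le) simp
  also have "\<dots> \<le> (\<Sum>u\<in>set xs. \<Sum>l<i. up l)"
    unfolding of_nat_sum
  proof (rule sum_mono)
    fix u assume "u \<in> set xs"
    then have "good u f j" using good[of u] set by (auto simp: good_def j)
    then show "real (card (explored n {u} f i)) \<le> (\<Sum>l<i. up l)"
      unfolding j by (rule card_explored_le)
  qed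
  also have "\<dots> = real (card (set xs)) * (\<Sum>l<i. up l)" by simp
  also have "\<dots> \<le> real s * (\<Sum>l<i. up l)"
    using card_length[of xs] len sum0 by (intro mult_right_mono) auto
  finally have "real (card (explored n (set xs) f i)) \<le> t" using t by linarith
  then have "(real n - t) * (1 - p) powr t / 2 < real (card ({1..n} - explored n (set xs) f (Suc i)))"
    using cov[OF len set] by (auto simp: badly_covered_def)
  \<comment> \<open>More than \<open>c + 2\<close> vertices are uncovered and fewer than
    \<open>c\<close> are unreached, so at least two vertices are uncovered but reached from
    everywhere.\<close>
  moreover have "card ({1..n} - explored n (set xs) f (Suc i)) - card (unreached f) \<le>
      card ({1..n} - explored n (set xs) f (Suc i) - unreached f)"
    by (rule diff_card_le_card_Diff) (simp add: unreached_def)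
  ultimately have "2 \<le> card ({1..n} - explored n (set xs) f (Suc i) - unreached f)"
    using unreached c by linarith
  then obtain x y where xy: "x \<noteq> y" "{x, y} \<subseteq> {1..n} - explored n (set xs) f (Suc i) - unreached f"
  proof -
    obtain T where T: "T \<subseteq> {1..n} - explored n (set xs) f (Suc i) - unreached f" "card T = 2"
      by (rule obtain_subset_with_card_n[OF \<open>2 \<le> _\<close>])
    then show ?thesis using that by (auto simp: card_2_iff)
  qed
  have dist: "graph_dist (graph_of n f) u z = enat (Suc i)" if "z \<in> {x, y}" "u \<in> S" for z u
  proof (rule graph_dist_eqI)
    show u: "u \<in> {1..n}" using that SV by auto
    show "z \<notin> explored n {u} f (Suc i)"
      using that xy(2) Sxs unfolding explored_UN[OF set] by auto
    show "z \<in> explored n {u} f (Suc (Suc i))"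
      using that xy(2) u by (auto simp: unreached_def)
  qed
  show "\<exists>x\<in>verts (graph_of n f). \<exists>y\<in>verts (graph_of n f). x \<noteq> y \<and> (\<forall>u\<in>S. \<forall>v\<in>S.
      graph_dist (graph_of n f) u x = graph_dist (graph_of n f) v x \<and>
      graph_dist (graph_of n f) u y = graph_dist (graph_of n f) v y)"
    using xy dist by (intro bexI[of _ x] bexI[of _ y]) (auto simp: graph_of_def)
qed

text \<open>The three error terms bound the events that some exploration is not good, that many
  vertices are unreached although all are good, and that some list of \<open>s\<close> vertices
  covers too much.\<close>

lemma prob_pq_number_ge:
  assumes i: "1 \<le> i" and c: "0 < c" "c + 2 \<le> (real n - t) * (1 - p) powr t / 2"
    and t: "real s * (\<Sum>l<i. up l) \<le> t" "t \<le> real n"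
    and k: "2 * k < real s + 1"
  shows "1 - (2 / real n + real n ^ 2 * exp (- (p * (d ^ i * \<beta> i))) / c +
             real n ^ s * exp (- ((real n - t) * (1 - p) powr t) / 16))
         \<le> measure_pmf.prob (binomial_random_graph n p)
              {G. pq_number G \<le> eq_number G \<and> ereal k \<le> ereal_of_enat (pq_number G)}"
    (is "1 - ?e \<le> measure_pmf.prob _ ?P")
proof -
  let ?M = "edge_pmf n p"
  define A1 where "A1 = {f. \<exists>u\<in>{1..n}. \<not> good u f i}"
  define A2 where "A2 = {f. (\<forall>u\<in>{1..n}. good u f i) \<and> c \<le> real (card (unreached f))}"
  define A3 where "A3 = {f. \<exists>xs. length xs = s \<and> set xs \<subseteq> {1..n} \<and> badly_covered t f (set xs)}"
  have "- (graph_of n -` ?P) \<subseteq> A1 \<union> (A2 \<union> A3)"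
  proof (rule subsetI, rule ccontr)
    fix f assume f: "f \<in> - (graph_of n -` ?P)" "f \<notin> A1 \<union> (A2 \<union> A3)"
    let ?G = "graph_of n f"
    have "adj_rel ?G \<subseteq> verts ?G \<times> verts ?G"
      using adj_rel_graph_of[of _ _ n f] by (auto simp: graph_of_def)
    then have "pq_number ?G \<le> eq_number ?G" by (rule pq_number_le_eq_number)
    moreover have "ereal k \<le> ereal_of_enat (pq_number ?G)"
      unfolding pq_number_def
    proof (rule query_number_ge)
      fix q \<sigma> assume "real q < k"
      \<comment> \<open>By integrality, \<open>2 * q < s + 1\<close> already gives
        \<open>2 * q \<le> s\<close>; this is why rounding \<open>2 * k\<close> down to
        \<open>s\<close> is harmless.\<close>
      then have q: "2 * q \<le> s" using k by linarith
      have good: "good u f i" if "u \<in> {1..n}" for u using that f(2) by (auto simp: A1_def)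
      have un: "real (card (unreached f)) < c" using f(2) by (auto simp: A1_def A2_def)
      have cov: "\<not> badly_covered t f (set xs)" if "length xs = s" "set xs \<subseteq> {1..n}" for xs
        using that f(2) by (auto simp: A3_def)
      show "\<not> locates_within ?G (verts ?G \<times> verts ?G) \<sigma> q"
        by (rule not_located[OF good i un cov t(1) c(2) q])
    qed
    ultimately show False using f(1) by simp
  qed
  then have "measure_pmf.prob ?M (- (graph_of n -` ?P)) \<le> measure_pmf.prob ?M (A1 \<union> (A2 \<union> A3))"
    by (intro measure_pmf.finite_measure_mono) auto
  also have "\<dots> \<le> measure_pmf.prob ?M A1 + (measure_pmf.prob ?M A2 + measure_pmf.prob ?M A3)"
    by (intro order_trans[OF measure_Un_le] add_left_mono
        measure_Un_le) auto
  also have "\<dots> \<le> ?e"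
    using prob_some_not_good prob_many_unreached[OF c(1)] prob_badly_covered[OF i t(2), of s]
    unfolding A1_def A2_def A3_def by linarith
  finally have "measure_pmf.prob ?M (- (graph_of n -` ?P)) \<le> ?e" .
  moreover have "measure_pmf.prob ?M (- (graph_of n -` ?P)) =
      1 - measure_pmf.prob ?M (graph_of n -` ?P)"
    using measure_pmf.prob_compl[of "graph_of n -` ?P" ?M] by (simp add: Compl_eq_Diff_UNIV)
  ultimately show ?thesis
    by (simp add: binomial_random_graph_eq)
qed

end

subsection \<open>Asymptotics\<close>

text \<open>All requirements on \<open>n\<close> and \<open>\<omega>\<close> are pointwise
  inequalities here, so that the theorem only has to check that they hold eventually.\<close>

lemma prob_pq_number_bound:
  fixes n i :: nat and p d w k :: real
  defines "l \<equiv> ln (real n)" and "a \<equiv> d ^ i" and "\<theta> \<equiv> w powr (-1/3)"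
  assumes p0: "0 \<le> p" and d: "d = p * real n" and i: "1 \<le> i"
    and k: "k = real n / (2 * a) * ln a * (1 - \<theta>)"
    and l1: "1 \<le> l" and w_l: "w \<le> l" and d_lo: "w * l \<le> d" and d_up: "d \<le> real n / w"
    and a_n: "a \<le> real n / 16" and da: "2 * l \<le> d * a / real n"
    and l_large: "l\<^sup>2 + l \<le> exp (l powr (2/3) / 4) / 32"
    and w1: "10000 \<le> w"
    and w2: "(1 - \<theta>) * (1 + 28 * w powr (-1/2)) * (1 + 2 / w)\<^sup>2 \<le> 1 - \<theta> / 2"
    and w3: "28 * w powr (-1/2) + 32 / w \<le> \<theta> / 16"
  shows "1 - (3 / real n + exp (- (l powr (2/3)) / 16)) \<le>
         measure_pmf.prob (binomial_random_graph n p)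
           {G. pq_number G \<le> eq_number G \<and> ereal k \<le> ereal_of_enat (pq_number G)}"
proof -
  have n1: "1 < real n"
  proof (rule ccontr)
    assume "\<not> 1 < real n"
    then have "n = 0 \<or> n = 1" by linarith
    then have "l = 0" by (auto simp: l_def)
    with l1 show False by simp
  qed
  have exp_l: "exp l = real n" using n1 by (simp add: l_def)
  \<comment> \<open>Chosen so that \<open>\<epsilon>\<^sup>2 * d\<close> is at least
    \<open>49 / w * (w * l) = 49 * l\<close>, just above the locale's requirement.\<close>
  define \<epsilon> where "\<epsilon> = 7 * w powr (-1/2)"
  have w_half: "w powr (-1/2) \<le> 1 / 100" "w powr (-1/2) > 0" "(w powr (-1/2))\<^sup>2 = 1 / w"
  proof -
    show "w powr (-1/2) > 0" using w1 by simp
    show sq: "(w powr (-1/2))\<^sup>2 = 1 / w"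
      using w1 powr_add[of w "-1/2" "-1/2"] powr_neg_one[of w] by (simp add: power2_eq_square)
    have "1 / w \<le> (1 / 100)\<^sup>2" using w1 by (simp add: power2_eq_square field_simps)
    then show "w powr (-1/2) \<le> 1 / 100"
      unfolding sq[symmetric] by (rule power2_le_imp_le) simp
  qed
  have \<theta>: "0 < \<theta>" "\<theta> \<le> 1"
    using w1 powr_mono[of "-1/3" 0 w] by (auto simp: \<theta>_def)
  \<comment> \<open>By \<open>w \<le> l\<close>, the gain \<open>exp (l * \<theta>)\<close> is
    bounded below by a function of \<open>n\<close> alone.\<close>
  have l\<theta>: "l powr (2/3) \<le> l * \<theta>"
  proof -
    have "l powr (-1/3) \<le> \<theta>" unfolding \<theta>_def using w1 w_l by (intro powr_mono2') auto
    then have "l * l powr (-1/3) \<le> l * \<theta>" using l1 by (intro mult_left_mono) auto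
    moreover have "l * l powr (-1/3) = l powr (2/3)"
      using l1 powr_add[of l 1 "-1/3"] by simp
    ultimately show ?thesis by simp
  qed
  have wl: "w * 1 \<le> w * l" using w1 l1 by (intro mult_left_mono) auto
  have d_w: "w \<le> d" using wl d_lo by linarith
  have p_w: "p \<le> 1 / w" using d_up n1 w1 by (simp add: d field_simps)
  have inv_w: "1 / w \<le> 1 / 10000" using w1 by (simp add: field_simps)
  have a_d: "d \<le> a" unfolding a_def using power_increasing[OF i, of d] d_w w1 by simp
  have a1: "1 < a" using a_d d_w w1 by linarith
  \<comment> \<open>From \<open>i \<ge> 1\<close> follows \<open>d \<le> a\<close>, hence
    \<open>n \<le> d * a \<le> a\<^sup>2\<close>.\<close>
  have ln_a: "l / 2 \<le> ln a" "ln a \<le> l"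
  proof -
    have "real n \<le> 2 * l * real n" using l1 n1 by simp
    also have "\<dots> \<le> d * a" using da n1 by (simp add: field_simps)
    also have "\<dots> \<le> a * a" using a_d a1 by (intro mult_right_mono) auto
    finally have "ln (real n) \<le> ln (a * a)" using n1 a1 by (subst ln_le_cancel_iff) auto
    then show "l / 2 \<le> ln a" using a1 by (simp add: l_def ln_mult)
    show "ln a \<le> l" unfolding l_def using a1 a_n n1 by (subst ln_le_cancel_iff) auto
  qed
  have "48 * l \<le> 49 / w * (w * l)" using l1 w1 by simp
  also have "\<dots> \<le> 49 / w * d" using d_lo w1 by (intro mult_left_mono) auto
  also have "\<dots> = \<epsilon>\<^sup>2 * d" unfolding \<epsilon>_def power_mult_distrib w_half(3) by simp
  finally have eps_d: "48 * l \<le> \<epsilon>\<^sup>2 * d" .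
  have p_less_1: "p < 1" using p_w inv_w by linarith
  interpret exploration n i p d \<epsilon>
  proof
    show "1 \<le> n" "0 \<le> p" "p < 1" "d = p * real n" "4 \<le> d" "48 * ln (real n) \<le> \<epsilon>\<^sup>2 * d" "d ^ i \<le> real n / 16"
      using n1 p0 p_less_1 d d_w w1 eps_d a_n by (auto simp: l_def a_def)
    show "0 < \<epsilon>" "\<epsilon> \<le> 1 / 8" using w_half by (auto simp: \<epsilon>_def)
  qed
  define y where "y = a / real n"
  have y: "0 < y" "y \<le> 1 / 16" using a1 a_n n1 by (auto simp: y_def field_simps)
  \<comment> \<open>The tolerated number of unreached vertices: large enough for Markov's inequality
    in \<open>e2\<close>, and small compared with \<open>\<mu>\<close>, which is at least of order
    \<open>Y\<^sup>2\<close>.\<close>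
  define Y where "Y = exp (l * \<theta> / 8)"
  have Y1: "1 \<le> Y" using l1 \<theta> by (simp add: Y_def)
  define s where "s = nat \<lfloor>2 * k\<rfloor>"
  have two_k: "2 * k = ln a * (1 - \<theta>) / y" using a1 n1 by (simp add: k y_def)
  have k0: "0 \<le> 2 * k" unfolding two_k using ln_a l1 \<theta> y by simp
  have s: "real s \<le> 2 * k" "2 * k < real s + 1"
    using k0 unfolding s_def by linarith+
  \<comment> \<open>Bounds the total size of \<open>2 * k\<close> balls of radius
    \<open>i - 1\<close>, each of size at most \<open>(1 + 4 * \<epsilon>) * a / (d - 1)\<close> by
    a geometric sum.\<close>
  define t where "t = real n * (ln a * (1 - \<theta>) * (1 + 4 * \<epsilon>)) / (d - 1)"
  have t_le: "real s * (\<Sum>l<i. up l) \<le> t"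
  proof -
    have "(\<Sum>l<i. up l) \<le> (\<Sum>l<i. d ^ l * (1 + 4 * \<epsilon>))" by (intro sum_mono up_bounds)
    also have "\<dots> = (\<Sum>l<i. d ^ l) * (1 + 4 * \<epsilon>)" by (simp only: sum_distrib_right)
    also have "\<dots> \<le> a / (d - 1) * (1 + 4 * \<epsilon>)"
      using sum_power_le[of d i] d_ge eps by (intro mult_right_mono) (auto simp: a_def pos_le_divide_eq)
    finally have "real s * (\<Sum>l<i. up l) \<le> 2 * k * (a / (d - 1) * (1 + 4 * \<epsilon>))"
      using s k0 d_ge by (intro mult_mono sum_nonneg order_trans[OF _ up_bounds(1)]) auto
    also have "\<dots> = t" using a1 n1 by (simp add: t_def two_k y_def)
    finally show ?thesis .
  qed
  have ln_\<theta>: "0 \<le> ln a * (1 - \<theta>)" "ln a * (1 - \<theta>) \<le> l * 1"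
    using ln_a l1 \<theta> by (simp, intro mult_mono, auto)
  have t0: "0 \<le> t" unfolding t_def using ln_\<theta> eps d_ge by simp
  have t_n: "t \<le> real n / 2"
  proof -
    have "ln a * (1 - \<theta>) * (1 + 4 * \<epsilon>) \<le> l * 1 * 2"
      by (rule mult_mono[OF ln_\<theta>(2)]) (use eps l1 in auto)
    also have "\<dots> \<le> (d - 1) / 2"
    proof -
      have "10000 * l \<le> w * l" using w1 l1 by (intro mult_right_mono) auto
      then have "10000 * l \<le> d" using d_lo by (rule order_trans)
      then show ?thesis using l1 by simp
    qed
    finally have "real n * (ln a * (1 - \<theta>) * (1 + 4 * \<epsilon>)) \<le> real n * ((d - 1) / 2)"
      by (intro mult_left_mono) auto
    then show ?thesis using d_ge by (simp add: t_def field_simps)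
  qed
  have powr_ge: "exp (- ln a * (1 - \<theta> / 2)) \<le> (1 - p) powr t"
  proof -
    \<comment> \<open>Up to small factors, \<open>t * p\<close> is
      \<open>ln a * (1 - \<theta>)\<close>. By \<open>w2\<close> these factors and the quadratic
      term of \<open>ln (1 - p)\<close> use up at most half of \<open>\<theta>\<close>.\<close>
    have tp: "t * p \<le> ln a * ((1 - \<theta>) * (1 + 4 * \<epsilon>) * (1 + 2 / w))"
    proof -
      have "t * p = ln a * ((1 - \<theta>) * (1 + 4 * \<epsilon>) * (d / (d - 1)))"
        by (simp add: t_def d mult_ac)
      also have "d / (d - 1) \<le> 1 + 2 / w"
      proof -
        have "d / (d - 1) = 1 + 1 / (d - 1)" using d_ge by (simp add: field_simps)
        also have "1 / (d - 1) \<le> 2 / w" using d_w w1 by (simp add: field_simps)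
        finally show ?thesis by simp
      qed
      finally show ?thesis using ln_a l1 \<theta> eps by (simp add: mult_left_mono)
    qed
    have "t * p * (1 + 2 * p) \<le> ln a * ((1 - \<theta>) * (1 + 4 * \<epsilon>) * (1 + 2 / w)) * (1 + 2 / w)"
      by (rule mult_mono[OF tp]) (use p_w p0 ln_a l1 \<theta> eps w1 in auto)
    also have "\<dots> = ln a * ((1 - \<theta>) * (1 + 28 * w powr (-1/2)) * (1 + 2 / w)\<^sup>2)"
      by (simp add: \<epsilon>_def power2_eq_square mult_ac)
    also have "\<dots> \<le> ln a * (1 - \<theta> / 2)" using w2 ln_a l1 by (intro mult_left_mono) auto
    finally have "- ln a * (1 - \<theta> / 2) \<le> t * (- p - 2 * p\<^sup>2)"
      by (simp add: algebra_simps power2_eq_square)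
    also have "\<dots> \<le> t * ln (1 - p)"
      using ln_one_minus_pos_lower_bound[of p] p0 p_w inv_w t0 by (intro mult_left_mono) auto
    finally show ?thesis using p(2) by (simp add: powr_def)
  qed
  define \<mu> where "\<mu> = (real n - t) * (1 - p) powr t"
  \<comment> \<open>The factor 2 comes from \<open>t \<le> n / 2\<close>, and
    \<open>exp (ln a * (\<theta> / 2))\<close> is at least \<open>Y\<^sup>2\<close> because
    \<open>ln a \<ge> l / 2\<close>.\<close>
  have \<mu>: "Y\<^sup>2 / (2 * y) \<le> \<mu>"
  proof -
    have "l / 2 * (\<theta> / 2) \<le> ln a * (\<theta> / 2)" using ln_a \<theta> by (intro mult_right_mono) auto
    then have "Y\<^sup>2 \<le> exp (ln a * (\<theta> / 2))" by (simp add: Y_def exp_double[symmetric])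
    then have "Y\<^sup>2 / a \<le> exp (ln a * (\<theta> / 2)) / a" using a1 by (intro divide_right_mono) auto
    also have "\<dots> = exp (- ln a * (1 - \<theta> / 2))" using a1 by (simp add: algebra_simps exp_diff)
    also note powr_ge
    finally have "real n / 2 * (Y\<^sup>2 / a) \<le> \<mu>"
      unfolding \<mu>_def using t_n a1 by (intro mult_mono) auto
    then show ?thesis using a1 n1 by (simp add: y_def field_simps)
  qed
  have c: "Y + 2 \<le> \<mu> / 2"
  proof -
    have "Y\<^sup>2 * 8 \<le> Y\<^sup>2 / (2 * y)"
      using y mult_left_mono[of "16 * y" 1 "Y\<^sup>2"] by (simp add: field_simps)
    moreover have "Y * 1 \<le> Y\<^sup>2" "1 * 1 \<le> Y\<^sup>2" unfolding power2_eq_square using Y1 by (intro mult_mono; simp)+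
    ultimately show ?thesis using \<mu> by linarith
  qed
  have e2: "real n ^ 2 * exp (- (p * (d ^ i * \<beta> i))) / Y \<le> exp (- (l powr (2/3)) / 16)"
  proof -
    define \<delta> where "\<delta> = 2 * \<epsilon> + 16 / w"
    have "16 / w = 16 * (1 / w)" "0 \<le> 1 / w" using w1 by simp_all
    then have \<delta>: "\<delta> \<le> 1" "0 \<le> \<delta>" using w_half(1,2) inv_w unfolding \<delta>_def \<epsilon>_def by linarith+
    have pd: "p * (d ^ i * \<beta> i) = d * y * \<beta> i" using n1 by (simp add: y_def a_def d)
    have "2 * l * (1 - \<delta>) \<le> d * y * \<beta> i"
    \<comment> \<open>If \<open>y\<close> is large, \<open>\<beta> i\<close> may be as small as
      \<open>1 / 2\<close>, but then \<open>d * y\<close> is at least \<open>4 * l\<close>. If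
      \<open>y\<close> is small, \<open>\<beta> i\<close> is at least \<open>1 - \<delta>\<close>
      and \<open>d * y \<ge> 2 * l\<close> is enough.\<close>
    proof (cases "4 / w \<le> y")
      case True
      have "w * l * (4 / w) \<le> d * y" using True d_lo d_ge w1 by (intro mult_mono) auto
      then have "4 * l \<le> d * y" using w1 by simp
      then have "4 * l * (1 / 2) \<le> d * y * \<beta> i"
        by (rule mult_mono) (use l1 beta_bounds[of i] d_ge y in auto)
      moreover have "2 * l * (1 - \<delta>) \<le> 2 * l * 1" using l1 \<delta> by (intro mult_left_mono) auto
      ultimately show ?thesis by linarith
    next
      case False
      have "2 * \<epsilon> * (1 - 1 / 2 ^ i) \<le> 2 * \<epsilon> * 1" using eps by (intro mult_left_mono) auto
      moreover have "\<beta> i = 1 - 2 * \<epsilon> * (1 - 1 / 2 ^ i) - 4 * y" by (simp add: \<beta>_def y_def a_def)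
      moreover have "16 / w = 4 * (4 / w)" by simp
      ultimately have "1 - \<delta> \<le> \<beta> i" using False unfolding \<delta>_def by linarith
      moreover have "2 * l \<le> d * y" using da by (simp add: y_def)
      ultimately show ?thesis
        by (intro mult_mono[of "2 * l"]) (use \<delta> l1 d_ge y in auto)
    qed
    then have "real n ^ 2 * exp (- (p * (d ^ i * \<beta> i))) \<le> exp l ^ 2 * exp (- (2 * l * (1 - \<delta>)))"
      unfolding pd exp_l by (intro mult_left_mono) auto
    also have "\<dots> = exp (l * (2 * \<delta>))"
      by (simp add: exp_double[symmetric] exp_add[symmetric] algebra_simps)
    \<comment> \<open>Here \<open>2 * \<delta>\<close> is exactly the left side of
      \<open>w3\<close>; this is the comparison of \<open>w powr (-1/2)\<close> with
      \<open>w powr (-1/3)\<close>.\<close>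
    also have "\<dots> \<le> exp (l * (\<theta> / 16))"
      using w3 l1 by (simp add: \<delta>_def \<epsilon>_def)
    finally have "real n ^ 2 * exp (- (p * (d ^ i * \<beta> i))) / Y \<le> exp (l * (\<theta> / 16)) / Y"
      by (intro divide_right_mono) (auto simp: Y_def)
    also have "\<dots> = exp (- (l * \<theta> / 16))" by (simp add: Y_def exp_diff[symmetric])
    also have "\<dots> \<le> exp (- (l powr (2/3)) / 16)" using l\<theta> by simp
    finally show ?thesis .
  qed
  have e3: "real n ^ s * exp (- \<mu> / 16) \<le> 1 / real n"
  proof -
    \<comment> \<open>The number of lists is \<open>exp (s * l)\<close> with
      \<open>s \<le> l / y\<close>. The hypothesis \<open>l_large\<close> lets
      \<open>\<mu> / 16\<close> exceed \<open>s * l\<close> by at least \<open>l\<close>.\<close>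
    have "exp (l powr (2/3) / 4) \<le> Y\<^sup>2" using l\<theta> by (simp add: Y_def exp_double[symmetric] mult.commute)
    then have "l\<^sup>2 + l \<le> Y\<^sup>2 / 32" using l_large by linarith
    then have "(l\<^sup>2 + l) / y \<le> Y\<^sup>2 / 32 / y" using y by (intro divide_right_mono) auto
    also have "\<dots> = Y\<^sup>2 / (2 * y) / 16" by simp
    also have "\<dots> \<le> \<mu> / 16" using \<mu> by (intro divide_right_mono) auto
    finally have 1: "l\<^sup>2 / y + l / y \<le> \<mu> / 16" by (simp add: add_divide_distrib)
    have "2 * k \<le> l / y" unfolding two_k using ln_\<theta> y by (intro divide_right_mono) auto
    then have "real s * l \<le> l / y * l" using s l1 by (intro mult_right_mono) auto
    then have 2: "real s * l \<le> l\<^sup>2 / y" by (simp add: power2_eq_square)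
    have "l * y \<le> l * 1" using y l1 by (intro mult_left_mono) auto
    then have 3: "l \<le> l / y" using y by (simp add: pos_le_divide_eq)
    have "real n ^ s * exp (- \<mu> / 16) = exp (real s * l - \<mu> / 16)"
      by (simp add: exp_l[symmetric] exp_of_nat_mult[symmetric] exp_add[symmetric])
    also have "\<dots> \<le> exp (- l)" unfolding exp_le_cancel_iff using 1 2 3 by linarith
    also have "\<dots> = 1 / real n" by (simp add: exp_minus exp_l inverse_eq_divide)
    finally show ?thesis .
  qed
  have "1 - (3 / real n + exp (- (l powr (2/3)) / 16)) \<le>
      1 - (2 / real n + real n ^ 2 * exp (- (p * (d ^ i * \<beta> i))) / Y +
             real n ^ s * exp (- \<mu> / 16))"
    using e2 e3 by simp
  also have "\<dots> \<le> measure_pmf.prob (binomial_random_graph n p)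
           {G. pq_number G \<le> eq_number G \<and> ereal k \<le> ereal_of_enat (pq_number G)}"
    unfolding \<mu>_def
    by (rule prob_pq_number_ge[OF i _ _ t_le _ s(2)]) (use Y1 c t_n n1 in \<open>auto simp: \<mu>_def\<close>)
  finally show ?thesis .
qed

theorem theorem3p2:
  fixes p d \<omega> k :: "nat \<Rightarrow> real" and i :: "nat \<Rightarrow> nat"
  assumes p_prob: "\<And>n. 0 \<le> p n \<and> p n \<le> 1"
    and d_def: "\<And>n. d n = p n * real n"
    and omega_lim: "filterlim \<omega> at_top sequentially"
    and omega_le: "\<forall>\<^sub>F n in sequentially. \<omega> n \<le> ln (real n)"
    and d_lower: "\<forall>\<^sub>F n in sequentially. \<omega> n * ln (real n) \<le> d n"
    and d_upper: "\<forall>\<^sub>F n in sequentially. d n \<le> real n / \<omega> n"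
    and i_pos: "\<And>n. i n \<ge> 1"
    and i_largest: "largest_exponent d i"
    and diam_cond: "filterlim (\<lambda>n. d n ^ (i n + 1) / real n - 2 * ln (real n)) at_top sequentially"
    and k_def: "\<And>n. k n = real n / (2 * d n ^ i n) * ln (d n ^ i n) * (1 - 1 / \<omega> n powr (1/3))"
  shows "asymptotically_almost_surely (\<lambda>n. binomial_random_graph n (p n))
           (\<lambda>n G. eq_number G \<ge> pq_number G \<and> ereal_of_enat (pq_number G) \<ge> ereal (k n))
         \<and> k \<in> \<Omega>(\<lambda>n. real n * ln (real n) / d n ^ i n)"
proof
  have k: "k n = real n / (2 * d n ^ i n) * ln (d n ^ i n) * (1 - \<omega> n powr (-1/3))" for n
    by (simp add: k_def powr_minus_divide)
  have ev_a: "\<forall>\<^sub>F n in sequentially. d n ^ i n \<le> real n / 16"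
  proof -
    have "(\<lambda>n. d n ^ i n) \<in> o(\<lambda>n. real n)"
      using i_largest by (simp add: largest_exponent_def)
    from landau_o.smallD[OF this, of "1/16"] show ?thesis
      by (rule eventually_rev_mp) (auto intro!: always_eventually)
  qed
  have ev_d: "\<forall>\<^sub>F n in sequentially. 2 * ln (real n) \<le> d n * d n ^ i n / real n"
    using diam_cond[unfolded filterlim_at_top, rule_format, of 0] by (simp add: eventually_mono)
  have ev_l: "\<forall>\<^sub>F n in sequentially. 1 \<le> ln (real n)"
    "\<forall>\<^sub>F n in sequentially. (ln (real n))\<^sup>2 + ln (real n) \<le> exp (ln (real n) powr (2/3) / 4) / 32"
    by real_asymp+
  \<comment> \<open>These conditions involve \<open>\<omega>\<close> only, so they are verified for
    a real variable tending to infinity and then composed with \<open>\<omega>\<close>.\<close>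
  have ev_w: "\<forall>\<^sub>F n in sequentially. 10000 \<le> \<omega> n"
    "\<forall>\<^sub>F n in sequentially. (1 - \<omega> n powr (-1/3)) * (1 + 28 * \<omega> n powr (-1/2)) * (1 + 2 / \<omega> n)\<^sup>2
       \<le> 1 - \<omega> n powr (-1/3) / 2"
    "\<forall>\<^sub>F n in sequentially. 28 * \<omega> n powr (-1/2) + 32 / \<omega> n \<le> \<omega> n powr (-1/3) / 16"
    by (rule eventually_compose_filterlim[OF _ omega_lim], real_asymp)+
  show "asymptotically_almost_surely (\<lambda>n. binomial_random_graph n (p n))
           (\<lambda>n G. eq_number G \<ge> pq_number G \<and> ereal_of_enat (pq_number G) \<ge> ereal (k n))"
    unfolding asymptotically_almost_surely_def
  proof (rule tendsto_sandwich)
    show "\<forall>\<^sub>F n in sequentially. 1 - (3 / real n + exp (- (ln (real n) powr (2/3)) / 16)) \<le>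
        measure_pmf.prob (binomial_random_graph n (p n))
          {G. pq_number G \<le> eq_number G \<and> ereal (k n) \<le> ereal_of_enat (pq_number G)}"
      using ev_a ev_d ev_l ev_w omega_le d_lower d_upper
    proof eventually_elim
      case (elim n)
      show ?case
        by (rule prob_pq_number_bound[OF _ d_def[of n] i_pos[of n] k[of n] elim(3,8,9,10,1,2,4,5,6,7)])
          (use p_prob in auto)
    qed
    show "\<forall>\<^sub>F n in sequentially. measure_pmf.prob (binomial_random_graph n (p n))
          {G. pq_number G \<le> eq_number G \<and> ereal (k n) \<le> ereal_of_enat (pq_number G)} \<le> 1"
      by simp
    show "(\<lambda>n. 1 - (3 / real n + exp (- (ln (real n) powr (2/3)) / 16))) \<longlonglongrightarrow> 1"
      by real_asymp
  qed auto
  show "k \<in> \<Omega>(\<lambda>n. real n * ln (real n) / d n ^ i n)"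
  \<comment> \<open>Three factors \<open>1 / 2\<close>: the one in \<open>k\<close>, one from
    \<open>ln (d n ^ i n) \<ge> ln n / 2\<close>, and one from
    \<open>1 - \<omega> n powr (-1/3) \<ge> 1 / 2\<close> for
    \<open>\<omega> n \<ge> 8\<close>.\<close>
  proof (rule landau_omega.bigI[of "1/8"])
    show "\<forall>\<^sub>F n in sequentially.
        1 / 8 * norm (real n * ln (real n) / d n ^ i n) \<le> norm (k n)"
      using ev_a ev_d ev_l(1) ev_w(1) d_lower eventually_gt_at_top[of 0]
    proof eventually_elim
      case (elim n)
      let ?a = "d n ^ i n"
      have "\<omega> n * 1 \<le> \<omega> n * ln (real n)" using elim by (intro mult_left_mono) auto
      then have d1: "1 \<le> d n" using elim by linarith
      have a1: "1 \<le> ?a" using d1 by (rule one_le_power)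
      have "d n ^ 1 \<le> ?a" by (rule power_increasing[OF i_pos d1])
      then have da: "d n * ?a \<le> ?a * ?a" using a1 by (intro mult_right_mono) auto
      have "real n * 1 \<le> real n * (2 * ln (real n))" using elim by (intro mult_left_mono) auto
      also have "\<dots> \<le> d n * ?a" using elim by (simp add: field_simps)
      also note da
      finally have "ln (real n) \<le> ln (?a * ?a)" using elim a1 by (subst ln_le_cancel_iff) auto
      moreover have "ln (?a * ?a) = ln ?a + ln ?a" using a1 by (intro ln_mult_pos) auto
      ultimately have "ln (real n) / 2 \<le> ln ?a" by linarith
      moreover have "\<omega> n powr (-1/3) \<le> 8 powr (-1/3)" using elim by (intro powr_mono2') auto
      then have "1 / 2 \<le> 1 - \<omega> n powr (-1/3)"
        using powr_powr[of "2::real" 3 "-1/3"] by (simp add: powr_minus)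
      ultimately have "real n / (2 * ?a) * (ln (real n) / 2) * (1 / 2) \<le> k n"
        unfolding k using elim a1 by (intro mult_mono) auto
      moreover have "real n / (2 * ?a) * (ln (real n) / 2) * (1 / 2) =
          1 / 8 * (real n * ln (real n) / ?a)" by simp
      moreover have "0 \<le> real n * ln (real n) / ?a" using elim a1 by simp
      ultimately show ?case by simp
    qed
  qed simp
qed

end
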